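(* Given $\omega\neq0$, it holds $$\partial_{\lambda=0}V_\lambda(t)=\Re\big(e^{i\omega t}\sigma(\omega)v\big),$$ where the complex mobility matrix $\sigma(\omega)=(\sigma_{j,k}(\omega))$ is the $d\times d$ matrix with complex entries given by $$\sigma_{j,k}(\omega)=\pi[c_j]\delta_{j,k}+\langle\gamma_j,(i\omega-\mathcal L^* )^{-1}\Psi_k\rangle=\pi[c_j]\delta_{j,k}+\int_0^{+\infty}\langle\gamma_j,e^{-(i\omega-\mathcal L^* )s}\Psi_k\rangle\,ds .$$ For the reversible random walk (i.e. $r^*(x,y)=r(x,y)$ for all $x,y$) it holds $\Psi(x)=-2\gamma(x)$ and $\mathcal L^*=\mathcal L$, thus implying that $\sigma(\omega)$ is symmetric and $$\sigma_{j,k}(\omega)=\pi[c_j]\delta_{j,k}-2\langle\gamma_j,(i\omega-\mathcal L)^{-1}\gamma_k\rangle=\pi[c_j]\delta_{j,k}-2\int_0^{+\infty}\langle\gamma_j,e^{-(i\omega-\mathcal L)s}\gamma_k\rangle\,ds .$$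
   Context: Let $N\ge1$ be an integer and $\mathbb T^d_N:=\mathbb Z^d/N\mathbb Z^d$. For $x\in\mathbb T^d_N$ and $e\in\mathbb Z^d$, $x+e$ is the sum modulo $N\mathbb Z^d$; $e$ with $|e|=1$ ranges over $\pm e_1,\dots,\pm e_d$, where $e_1,\dots,e_d$ is the canonical basis of $\mathbb R^d$. The unperturbed process $(X_t)_{t\ge0}$ is the continuous-time random walk on $\mathbb T^d_N$ jumping between nearest-neighbour points with jump rates $r(x,y)>0$ (and $r(x,y):=0$ if $x,y$ are not nearest neighbours); $\pi$ is its unique invariant distribution, $\pi[f]:=\sum_x\pi(x)f(x)$, and $r^*(x,y):=\pi(y)r(y,x)/\pi(x)$ are the time-reversed jump rates. Fix a unit vector $v\in\mathbb R^d$ and $\omega\in\mathbb R\setminus\{0\}$. Given $\lambda>0$, the perturbed random walk $(X^\lambda_t)_{t\ge0}$ has at time $t$ jump rates $r^\lambda_t(x,y):=\exp\{\lambda\cos(\omega t)\,(y-x)\cdot v\}\,r(x,y)$ for $x,y$ nearest neighbours, and $r^\lambda_t(x,y):=0$ otherwise, where $\cdot$ is the Euclidean scalar product. Let $T$ be the period of $\cos(\omega t)$. Then $\pi_\lambda$ denotes the unique invariant distribution of the discrete-time chain $(X^\lambda_{nT})_{n\ge0}$, and $\mathbb E_{\pi_\lambda}$ is expectation when $X^\lambda_0$ has distribution $\pi_\lambda$ (oscillatory steady state). $(Y^\lambda_t)_{t\ge0}$ is the random walk obtained by lifting $(X^\lambda_t)_{t\ge0}$ to $\mathbb Z^d$,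 and the mean instantaneous velocity at time $t$ in the oscillatory steady state is $$V_\lambda(t):=\frac{d}{dt}\mathbb E_{\pi_\lambda}[Y^\lambda_t]=\sum_{e:|e|=1}\mathbb E_{\pi_\lambda}\big[r^\lambda_t(X^\lambda_t,X^\lambda_t+e)\big]\,e .$$ The value $\lambda=0$ corresponds to the unperturbed process. $L^2(\pi)$ is the complex Hilbert space of functions on $\mathbb T^d_N$ with scalar product $\langle f,h\rangle=\sum_x\pi(x)\overline{f(x)}h(x)$. The Markov generator of $(X_t)_{t\ge0}$ is $\mathcal Lf(x)=\sum_yr(x,y)[f(y)-f(x)]$ and its adjoint in $L^2(\pi)$ is $\mathcal L^*f(x)=\sum_yr^*(x,y)[f(y)-f(x)]$. The operator $i\omega-\mathcal L^*$ is invertible on $L^2(\pi)$. The functions $c,\gamma,\Psi:\mathbb T^d_N\to\mathbb R^d$, with components $c_j,\gamma_j,\Psi_j$, are $$c(x):=\sum_{j=1}^d[r(x,x+e_j)+r(x,x-e_j)]e_j,$$ $$\gamma(x):=\sum_{j=1}^d[r(x,x+e_j)-r(x,x-e_j)]e_j=\sum_{e:|e|=1}r(x,x+e)\,e,$$ $$\Psi(x):=-\sum_{e:|e|=1}\big(r^*(x,x+e)+r(x,x+e)\big)e .$$ $\Re$ denotes real part (componentwise), $\delta_{j,k}$ is the Kronecker delta, and $\partial_{\lambda=0}$ is the derivative in $\lambda$ at $\lambda=0$. *)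

theory Defs
  imports
    "HOL-Probability.Probability"
    "Berlekamp_Zassenhaus.Finite_Field"
begin

section \<open>The discrete torus\<close>

text \<open>
  The type \<open>'n mod_ring\<close> is the ring of integers modulo \<open>N = CARD('n)\<close>, for an arbitrary finite type
  \<open>'n\<close>, so that \<open>N \<ge> 1\<close> is arbitrary; the dimension is \<open>d = CARD('d)\<close>.
\<close>

type_synonym ('n, 'd) torus = "('n mod_ring) ^ 'd"

definition to_torus :: "int ^ 'd \<Rightarrow> ('n::finite, 'd::finite) torus" where
  "to_torus z = (\<chi> i. of_int_mod_ring (z $ i))"

definition steps :: "(int ^ 'd::finite) set" where
  "steps = (\<Union>j. {axis j 1, - axis j 1})"

definition real_vec :: "int ^ 'd \<Rightarrow> real ^ 'd::finite" where
  "real_vec z = (\<chi> i. real_of_int (z $ i))"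

section \<open>Markov jump processes with time-dependent rates\<close>

text \<open>
  \<open>q t x y\<close> is the rate at time \<open>t\<close> of a jump from \<open>x\<close> to \<open>y\<close>, and \<open>P s t x y\<close> is the probability of
  being in \<open>y\<close> at time \<open>t\<close> given state \<open>x\<close> at time \<open>s\<close>; \<open>P\<close> is specified by Kolmogorov's forward
  equation. Diagonal entries \<open>q t x x\<close> are irrelevant, since they cancel in the equation.
\<close>

definition transition_function ::
    "(real \<Rightarrow> 's \<Rightarrow> 's \<Rightarrow> real) \<Rightarrow> (real \<Rightarrow> real \<Rightarrow> 's \<Rightarrow> 's \<Rightarrow> real) \<Rightarrow> bool" where
  "transition_function q P \<longleftrightarrow>
     (\<forall>s\<ge>0. \<forall>x.
        (\<forall>y. P s s x y = of_bool (x = y)) \<and>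
        (\<forall>t\<ge>s. (\<forall>y. 0 \<le> P s t x y) \<and> (P s t x has_sum 1) UNIV \<and>
           (\<forall>y. ((\<lambda>u. P s u x y) has_real_derivative
                  (\<Sum>\<^sub>\<infinity>z. P s t x z * q t z y) - P s t x y * (\<Sum>\<^sub>\<infinity>z. q t y z))
                (at t within {s..}))))"

definition markov_process ::
    "'w measure \<Rightarrow> (real \<Rightarrow> real \<Rightarrow> 's \<Rightarrow> 's \<Rightarrow> real) \<Rightarrow> (real \<Rightarrow> 'w \<Rightarrow> 's) \<Rightarrow> bool" where
  "markov_process M P X \<longleftrightarrow>
     prob_space M \<and>
     (\<forall>t\<ge>0. X t \<in> measurable M (count_space UNIV)) \<and>
     (\<forall>(n::nat) (t :: nat \<Rightarrow> real) (a :: nat \<Rightarrow> 's).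
        0 \<le> t 0 \<and> (\<forall>i<n. t i \<le> t (Suc i)) \<longrightarrow>
        measure M {w \<in> space M. \<forall>i\<le>n. X (t i) w = a i} =
        measure M {w \<in> space M. X (t 0) w = a 0} *
          (\<Prod>i<n. P (t i) (t (Suc i)) (a i) (a (Suc i))))"

definition invariant_distribution :: "('s::finite \<Rightarrow> 's \<Rightarrow> real) \<Rightarrow> ('s \<Rightarrow> real) \<Rightarrow> bool" where
  "invariant_distribution K \<mu> \<longleftrightarrow>
     (\<forall>x. 0 \<le> \<mu> x) \<and> (\<Sum>x\<in>UNIV. \<mu> x) = 1 \<and> (\<forall>y. (\<Sum>x\<in>UNIV. \<mu> x * K x y) = \<mu> y)"

section \<open>The random walks\<close>

text \<open>
  Jump rates are indexed by a site \<open>x\<close> and a direction \<open>e \<in> steps\<close>: \<open>r x e\<close> is \<open>r(x, x + e)\<close>, the rate of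
  the jump of \<open>x\<close> along \<open>e\<close>. For \<open>N \<ge> 3\<close> this is the same as a function on pairs of
  nearest neighbours. For \<open>N \<le> 2\<close> distinct directions may lead to the same site, and only the
  direction gives a meaning to the displacement \<open>y - x\<close> and to the lift of a jump to the integer lattice.
\<close>

type_synonym ('n, 'd) rates = "('n, 'd) torus \<Rightarrow> int ^ 'd \<Rightarrow> real"

definition perturbed_rates ::
    "('n::finite, 'd::finite) rates \<Rightarrow> real ^ 'd \<Rightarrow> real \<Rightarrow> real \<Rightarrow> real \<Rightarrow> ('n, 'd) rates" where
  "perturbed_rates r v \<omega> lam t x e = exp (lam * cos (\<omega> * t) * (real_vec e \<bullet> v)) * r x e"

definition torus_rate ::
    "('n::finite, 'd::finite) rates \<Rightarrow> ('n, 'd) torus \<Rightarrow> ('n, 'd) torus \<Rightarrow> real" where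
  "torus_rate r x y = (\<Sum>e \<in> {e \<in> steps. x + to_torus e = y}. r x e)"

definition lattice_rate ::
    "('n::finite, 'd::finite) rates \<Rightarrow> int ^ 'd \<Rightarrow> int ^ 'd \<Rightarrow> real" where
  "lattice_rate r y z = (if z - y \<in> steps then r (to_torus y) (z - y) else 0)"

text \<open>
  The position \<open>Y 0\<close> may be any integrable lift of \<open>X 0\<close>, for instance its representative in
  the box with sides \<open>{0..<N}\<close>.
\<close>

definition lifted_walk ::
    "'w measure \<Rightarrow> (real \<Rightarrow> ('n::finite, 'd::finite) rates) \<Rightarrow>
     (real \<Rightarrow> 'w \<Rightarrow> ('n, 'd) torus) \<Rightarrow> (real \<Rightarrow> 'w \<Rightarrow> int ^ 'd) \<Rightarrow> bool" where
  "lifted_walk M r X Y \<longleftrightarrow>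
     (\<forall>t\<ge>0. \<forall>w\<in>space M. to_torus (Y t w) = X t w) \<and>
     integrable M (\<lambda>w. real_vec (Y 0 w)) \<and>
     (\<exists>P. transition_function (\<lambda>t. lattice_rate (r t)) P \<and> markov_process M P Y)"

definition mean_velocity :: "'w measure \<Rightarrow> (real \<Rightarrow> 'w \<Rightarrow> int ^ 'd::finite) \<Rightarrow> real \<Rightarrow> real ^ 'd" where
  "mean_velocity M Y t =
     vector_derivative (\<lambda>s. \<integral>w. real_vec (Y s w) \<partial>M) (at t within {0..})"

section \<open>Operators and the complex mobility matrix\<close>

definition rev_rates ::
    "('n::finite, 'd::finite) rates \<Rightarrow> (('n, 'd) torus \<Rightarrow> real) \<Rightarrow> ('n, 'd) rates" where
  "rev_rates r \<pi> x e = \<pi> (x + to_torus e) * r (x + to_torus e) (- e) / \<pi> x"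

definition reversible ::
    "('n::finite, 'd::finite) rates \<Rightarrow> (('n, 'd) torus \<Rightarrow> real) \<Rightarrow> bool" where
  "reversible r \<pi> \<longleftrightarrow> (\<forall>x. \<forall>e\<in>steps. rev_rates r \<pi> x e = r x e)"

definition jump_generator ::
    "('n::finite, 'd::finite) rates \<Rightarrow> (('n, 'd) torus \<Rightarrow> complex) \<Rightarrow> ('n, 'd) torus \<Rightarrow> complex" where
  "jump_generator r f x = (\<Sum>y\<in>UNIV. of_real (torus_rate r x y) * (f y - f x))"

definition mean :: "('s::finite \<Rightarrow> real) \<Rightarrow> ('s \<Rightarrow> real) \<Rightarrow> real" where
  "mean \<pi> f = (\<Sum>x\<in>UNIV. \<pi> x * f x)"

definition l2_inner :: "('s::finite \<Rightarrow> real) \<Rightarrow> ('s \<Rightarrow> complex) \<Rightarrow> ('s \<Rightarrow> complex) \<Rightarrow> complex" where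
  "l2_inner \<pi> f h = (\<Sum>x\<in>UNIV. of_real (\<pi> x) * cnj (f x) * h x)"

definition freq_minus :: "real \<Rightarrow> (('s \<Rightarrow> complex) \<Rightarrow> 's \<Rightarrow> complex) \<Rightarrow> ('s \<Rightarrow> complex) \<Rightarrow> 's \<Rightarrow> complex" where
  "freq_minus \<omega> A f x = \<i> * of_real \<omega> * f x - A f x"

text \<open>\<open>exp_op A s\<close> is the operator exponential of \<open>- s A\<close>, as a power series.\<close>

definition exp_op :: "(('s \<Rightarrow> complex) \<Rightarrow> 's \<Rightarrow> complex) \<Rightarrow> real \<Rightarrow> ('s \<Rightarrow> complex) \<Rightarrow> 's \<Rightarrow> complex" where
  "exp_op A s f x = (\<Sum>n. of_real ((- s) ^ n / fact n) * (A ^^ n) f x)"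

definition c_fun :: "('n::finite, 'd::finite) rates \<Rightarrow> ('n, 'd) torus \<Rightarrow> real ^ 'd" where
  "c_fun r x = (\<chi> j. r x (axis j 1) + r x (- axis j 1))"

definition gamma_fun :: "('n::finite, 'd::finite) rates \<Rightarrow> ('n, 'd) torus \<Rightarrow> real ^ 'd" where
  "gamma_fun r x = (\<chi> j. r x (axis j 1) - r x (- axis j 1))"

definition Psi_fun ::
    "('n::finite, 'd::finite) rates \<Rightarrow> (('n, 'd) torus \<Rightarrow> real) \<Rightarrow> ('n, 'd) torus \<Rightarrow> real ^ 'd" where
  "Psi_fun r \<pi> x = - (\<Sum>e\<in>steps. (rev_rates r \<pi> x e + r x e) *\<^sub>R real_vec e)"

definition cplx_comp :: "('s \<Rightarrow> real ^ 'd) \<Rightarrow> 'd \<Rightarrow> 's \<Rightarrow> complex" where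
  "cplx_comp F j = (\<lambda>x. of_real (F x $ j))"

text \<open>\<open>inv_into UNIV\<close> is the inverse function, whose short notation is taken here by HOL-Algebra.\<close>

definition mobility ::
    "('n::finite, 'd::finite) rates \<Rightarrow> (('n, 'd) torus \<Rightarrow> real) \<Rightarrow> real \<Rightarrow> complex ^ 'd ^ 'd" where
  "mobility r \<pi> \<omega> = (\<chi> j k.
     of_real (mean \<pi> (\<lambda>x. c_fun r x $ j)) * of_bool (j = k) +
     l2_inner \<pi> (cplx_comp (gamma_fun r) j)
       (inv_into UNIV (freq_minus \<omega> (jump_generator (rev_rates r \<pi>))) (cplx_comp (Psi_fun r \<pi>) k)))"

end

theory Submission
  imports Defs
begin

text \<open>
  By a truncated Dynkin formula on the lattice, the mean velocity is the average drift under the law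
  \<open>\<mu>\<close> of the walk on the torus. The density \<open>u = \<mu> / \<pi>\<close> solves \<open>u' = L* u + F\<close> with \<open>F = O(lam)\<close>, and it is
  periodic. A periodic solution with zero mean of such an equation is bounded by a multiple of
  \<open>sup F\<close>: at a maximum of its \<open>L\<^sup>2(\<pi>)\<close> norm the spectral gap of \<open>L*\<close> must be compensated by
  \<open>F\<close>. Applied twice, this gives \<open>u = 1 + lam W + O(lam\<^sup>2)\<close> for the periodic solution
  \<open>W = Re (exp (i \<omega> t) h)\<close> of the linearized equation, where \<open>h = (i \<omega> - L* )\<^sup>-\<^sup>1 (\<Psi> \<bullet> v)\<close>. The same gap makes
  \<open>i \<omega> - L*\<close> invertible and its semigroup decay exponentially on functions with zero mean,
  such as \<open>\<Psi>\<close>, whence the integral formulas.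
\<close>

section \<open>Steps and the torus\<close>

text \<open>For each \<open>lam\<close> the steady state is known only as a fixed point of the
  period map. Rather than perturbing that fixed point, the proof lets periodicity stand in for an
  initial condition and uses a bound whose constant depends on \<open>\<pi>\<close> and the gap
  alone, hence is the same for all \<open>lam\<close>, times and sources. Dividing by
  \<open>\<pi>\<close> turns the forward equation into one for the reversed generator, for which
  constants are stationary; two probability laws differ by a density of zero
  \<open>\<pi>\<close>-mean, exactly the space on which the gap acts. The rates may be asymmetric:
  the quadratic form of the generator sees only its symmetric part, which degenerates on constants
  only, as the torus is connected. The condition \<omega> \<noteq> 0 excludes the constants from the
  kernel of the resolvent equation. A separate obstacle is the position itself, an unbounded
  function on an infinite state space of which only the initial first moment is given. Cutoffs with
  increments at most 1 along a step bound every truncated drift by one constant, and so permit the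
  passage to the limit.\<close>

lemma sum_steps: "(\<Sum>e\<in>(steps :: (int ^ 'd::finite) set). g e) = (\<Sum>j\<in>UNIV. g (axis j 1) + g (- axis j 1))"
  for g :: "_ \<Rightarrow> 'a::comm_monoid_add"
proof -
  \<comment> \<open>Over the integers 1 and -1 differ, so the 2d directions are distinct. On the
    torus they may coincide when N \<le> 2, which is why directions are kept as lattice
    vectors.\<close>
  have ne: "axis j 1 \<noteq> (- axis k 1 :: int ^ 'd)" for j k
  proof
    assume "axis j 1 = (- axis k 1 :: int ^ 'd)"
    then have "axis j 1 $ j = (- axis k 1 :: int ^ 'd) $ j" by simp
    then show False by (simp add: axis_def split: if_splits)
  qed
  have "(\<Sum>e\<in>(steps :: (int ^ 'd) set). g e) = (\<Sum>j\<in>UNIV. sum g {axis j 1, - axis j 1})"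
    unfolding steps_def
    by (rule sum.UNION_disjoint)
      (use ne in \<open>auto simp: axis_eq_axis dest: sym\<close>)
  also have "\<dots> = (\<Sum>j\<in>UNIV. g (axis j 1) + g (- axis j 1))"
    using ne by (intro sum.cong) auto
  finally show ?thesis .
qed

lemma finite_steps [simp]: "finite (steps :: (int ^ 'd::finite) set)"
  by (simp add: steps_def)

lemma axis_in_steps [simp]: "axis j 1 \<in> steps"
  by (auto simp: steps_def)

lemma steps_nonempty [simp]: "steps \<noteq> {}"
  by (metis axis_in_steps empty_iff)

lemma uminus_steps [simp]: "- e \<in> steps \<longleftrightarrow> e \<in> steps"
proof -
  have "- e \<in> steps" if "e \<in> steps" for e :: "int ^ 'a"
    using that by (auto simp: steps_def)
  from this[of e] this[of "- e"] show ?thesis by auto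
qed

lemma sum_steps_uminus: "(\<Sum>e\<in>steps. g (- e)) = (\<Sum>e\<in>steps. g e)"
  for g :: "_ \<Rightarrow> 'a::comm_monoid_add"
  by (rule sum.reindex_bij_witness[of _ uminus uminus]) auto

lemma norm_real_vec_step: "e \<in> steps \<Longrightarrow> norm (real_vec e) = 1"
proof -
  have "real_vec (axis j 1) = axis j 1" for j :: 'a
    by (simp add: real_vec_def vec_eq_iff axis_def)
  moreover have "real_vec (- axis j 1) = - axis j 1" for j :: 'a
    by (simp add: real_vec_def vec_eq_iff axis_def)
  ultimately show "e \<in> steps \<Longrightarrow> norm (real_vec e) = 1"
    by (auto simp: steps_def)
qed

lemma real_vec_add: "real_vec (x + y) = real_vec x + real_vec y"
  by (simp add: real_vec_def vec_eq_iff)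

lemma real_vec_uminus [simp]: "real_vec (- x) = - real_vec x"
  by (simp add: real_vec_def vec_eq_iff)

lemma real_vec_component [simp]: "real_vec x $ j = real_of_int (x $ j)"
  by (simp add: real_vec_def)

lemma of_int_mod_ring_plus:
  "of_int_mod_ring (a + b) = of_int_mod_ring a + (of_int_mod_ring b :: 'n::finite mod_ring)"
  by transfer (simp add: mod_simps)

lemma to_torus_add: "to_torus (x + y) = to_torus x + (to_torus y :: ('n::finite, 'd::finite) torus)"
  by (simp add: to_torus_def vec_eq_iff of_int_mod_ring_plus)

lemma to_torus_zero [simp]: "to_torus 0 = (0 :: ('n::finite, 'd::finite) torus)"
  by (simp add: to_torus_def vec_eq_iff)

lemma to_torus_uminus [simp]: "to_torus (- x) = - (to_torus x :: ('n::finite, 'd::finite) torus)"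
  by (metis add_eq_0_iff2 left_minus to_torus_add to_torus_zero)

lemma surj_to_torus: "\<exists>z. to_torus z = (x :: ('n::finite, 'd::finite) torus)"
  by (rule exI[of _ "\<chi> i. to_int_mod_ring (x $ i)"]) (simp add: to_torus_def vec_eq_iff)

lemma sum_torus_shift: "(\<Sum>x\<in>UNIV. g (x + a)) = (\<Sum>x\<in>UNIV. g x)"
  for g :: "('n::finite, 'd::finite) torus \<Rightarrow> 'a::comm_monoid_add"
  by (rule sum.reindex_bij_witness[of _ "\<lambda>x. x - a" "\<lambda>x. x + a"]) auto

text \<open>The lattice vectors whose translation preserves \<open>Q\<close> form a set
  \<open>H\<close> that is closed under addition and contains the steps, hence all integer multiples
  of basis vectors and all lattice vectors. This is the irreducibility behind the positivity of
  \<open>\<pi>\<close> and the constancy of functions of zero energy.\<close>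

lemma torus_connected:
  fixes x y :: "('n::finite, 'd::finite) torus"
  assumes closed: "\<And>x e. Q x \<Longrightarrow> e \<in> steps \<Longrightarrow> Q (x + to_torus e)"
    and "Q x"
  shows "Q y"
proof -
  define H where "H = {z :: int ^ 'd. \<forall>x. Q x \<longrightarrow> Q (x + to_torus z)}"
  have add: "a + b \<in> H" if "a \<in> H" "b \<in> H" for a b
    using that by (auto simp: H_def to_torus_add add.assoc[symmetric])
  have zero: "0 \<in> H" by (simp add: H_def)
  have steps: "e \<in> H" if "e \<in> steps" for e
    using that closed by (simp add: H_def)
  have axis: "axis i k \<in> H" for i k
  proof (induction k rule: int_induct[of _ 0])
    case base
    then show ?case using zero by (simp add: axis_def zero_vec_def)
  next
    case (step1 k)
    have "axis i (k + 1) = axis i k + (axis i 1 :: int ^ 'd)"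
      by (simp add: axis_def vec_eq_iff)
    then show ?case using add[OF step1(2) steps[of "axis i 1"]] by simp
  next
    case (step2 k)
    have "axis i (k - 1) = axis i k + (- axis i 1 :: int ^ 'd)"
      by (simp add: axis_def vec_eq_iff)
    then show ?case using add[OF step2(2) steps[of "- axis i 1"]] by simp
  qed
  have sums: "(\<Sum>i\<in>I. axis i (z $ i)) \<in> H" if "finite I" for I and z :: "int ^ 'd"
    using that by (induction) (auto intro: add zero axis)
  have all: "z \<in> H" for z
  proof -
    have "z = (\<Sum>i\<in>UNIV. axis i (z $ i))"
      by (simp add: vec_eq_iff axis_def sum.delta)
    then show ?thesis using sums[of UNIV z] by simp
  qed
  obtain z where "to_torus z = y - x" using surj_to_torus by blast
  then show ?thesis using all[of z] \<open>Q x\<close> by (auto simp: H_def)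
qed

text \<open>Directions are grouped by their target. For N = 2 opposite directions reach the same
  site and for N = 1 every step is a loop; sums over directions treat all cases at once.\<close>

lemma sum_torus_rate:
  fixes r :: "('n::finite, 'd::finite) rates" and g :: "('n, 'd) torus \<Rightarrow> 'a::real_algebra_1"
  shows "(\<Sum>y\<in>UNIV. of_real (torus_rate r x y) * g y) = (\<Sum>e\<in>steps. of_real (r x e) * g (x + to_torus e))"
proof -
  have "(\<Sum>e\<in>steps. of_real (r x e) * g (x + to_torus e)) =
      (\<Sum>y\<in>UNIV. \<Sum>e\<in>{e \<in> steps. x + to_torus e = y}. of_real (r x e) * g (x + to_torus e))"
    by (rule sum.group[symmetric]) auto
  also have "\<dots> = (\<Sum>y\<in>UNIV. of_real (torus_rate r x y) * g y)"
    by (simp add: torus_rate_def sum_distrib_right)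
  finally show ?thesis by simp
qed

lemma sum_torus_rate_into:
  fixes r :: "('n::finite, 'd::finite) rates" and g :: "('n, 'd) torus \<Rightarrow> real"
  shows "(\<Sum>z\<in>UNIV. g z * torus_rate r z y) = (\<Sum>e\<in>steps. g (y - to_torus e) * r (y - to_torus e) e)"
proof -
  have "(\<Sum>z\<in>UNIV. g z * torus_rate r z y) =
      (\<Sum>z\<in>UNIV. \<Sum>e\<in>{e \<in> steps. z = y - to_torus e}. g (y - to_torus e) * r (y - to_torus e) e)"
    unfolding torus_rate_def sum_distrib_left
    by (intro sum.cong) (auto simp: algebra_simps)
  also have "\<dots> = (\<Sum>z\<in>UNIV. \<Sum>e\<in>{e \<in> steps. y - to_torus e = z}. g (y - to_torus e) * r (y - to_torus e) e)"
    by (simp only: eq_commute)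
  also have "\<dots> = (\<Sum>e\<in>steps. g (y - to_torus e) * r (y - to_torus e) e)"
    by (rule sum.group) auto
  finally show ?thesis .
qed

lemma sum_torus_rate_out:
  "(\<Sum>y\<in>UNIV. torus_rate r x y) = (\<Sum>e\<in>steps. r x e)"
  using sum_torus_rate[of r x "\<lambda>_. 1 :: real"] by simp

section \<open>The reversed generator and its spectral gap\<close>

text \<open>Invariance enters in its infinitesimal form, the balance of inflow and outflow at each
  site; the final proof recovers it from the transition function at time 0.\<close>

locale stationary_walk =
  fixes r :: "('n::finite, 'd::finite) rates" and \<pi> :: "('n, 'd) torus \<Rightarrow> real"
  assumes rates_pos: "e \<in> steps \<Longrightarrow> 0 < r x e"
    and pi_nonneg: "0 \<le> \<pi> x"
    and pi_sum: "(\<Sum>x\<in>UNIV. \<pi> x) = 1"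
    and stationary: "(\<Sum>e\<in>steps. \<pi> (y - to_torus e) * r (y - to_torus e) e) = \<pi> y * (\<Sum>e\<in>steps. r y e)"
begin

text \<open>Zero mass at a site forces zero inflow, hence zero mass at all its neighbours because
  the rates are positive; connectedness would spread it everywhere, against total mass 1.\<close>

lemma pi_pos: "0 < \<pi> x"
proof (rule ccontr)
  assume "\<not> 0 < \<pi> x"
  then have x: "\<pi> x = 0" using pi_nonneg[of x] by simp
  have "\<pi> y = 0" for y
  proof (rule torus_connected[where Q = "\<lambda>z. \<pi> z = 0", OF _ x])
    fix z :: "('n, 'd) torus" and e :: "int ^ 'd"
    assume z: "\<pi> z = 0" and e: "e \<in> steps"
    have "(\<Sum>e\<in>steps. \<pi> (z - to_torus e) * r (z - to_torus e) e) = 0"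
      using stationary[of z] z by simp
    then have "\<forall>e\<in>steps. \<pi> (z - to_torus e) * r (z - to_torus e) e = 0"
      by (subst (asm) sum_nonneg_eq_0_iff) (auto intro!: mult_nonneg_nonneg pi_nonneg less_imp_le[OF rates_pos])
    then have "\<pi> (z + to_torus e) * r (z + to_torus e) (- e) = 0"
      using e by (auto dest: bspec[of _ _ "- e"])
    then show "\<pi> (z + to_torus e) = 0" using rates_pos[of "- e" "z + to_torus e"] e by auto
  qed
  then show False using pi_sum by simp
qed

lemma pi_le_1: "\<pi> x \<le> 1"
proof -
  have "\<pi> x \<le> (\<Sum>x\<in>UNIV. \<pi> x)" by (rule member_le_sum) (auto simp: pi_nonneg)
  then show ?thesis by (simp add: pi_sum)
qed

abbreviation rs :: "('n, 'd) rates" where "rs \<equiv> rev_rates r \<pi>"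

lemma pi_rs: "\<pi> x * rs x e = \<pi> (x + to_torus e) * r (x + to_torus e) (- e)"
  using pi_pos[of x] by (simp add: rev_rates_def)

lemma rs_pos: "e \<in> steps \<Longrightarrow> 0 < rs x e"
  unfolding rev_rates_def by (intro divide_pos_pos mult_pos_pos pi_pos rates_pos) auto

text \<open>This is the stationarity equation divided by \<open>\<pi> y\<close>, once each direction
  is reversed. It lets the outflow term of the forward equation be read as that of
  \<open>rs\<close>.\<close>

lemma sum_rs: "(\<Sum>e\<in>steps. rs y e) = (\<Sum>e\<in>steps. r y e)"
proof -
  have "\<pi> y * (\<Sum>e\<in>steps. rs y e) = (\<Sum>e\<in>steps. \<pi> (y + to_torus e) * r (y + to_torus e) (- e))"
    by (simp add: sum_distrib_left pi_rs)
  also have "\<dots> = (\<Sum>e\<in>steps. \<pi> (y - to_torus e) * r (y - to_torus e) e)"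
    by (subst sum_steps_uminus[symmetric]) simp
  also have "\<dots> = \<pi> y * (\<Sum>e\<in>steps. r y e)" by (rule stationary)
  finally show ?thesis using pi_pos[of y] by simp
qed

text \<open>Moving the base point to the arrival site and reversing the direction turns the weights
  of \<open>rs\<close> back into those of \<open>r\<close>. Together with \<open>sum_rs\<close> it
  yields the invariance of \<open>\<pi>\<close> under the reversed walk.\<close>

lemma sum_rs_shift:
  fixes g :: "('n, 'd) torus \<Rightarrow> 'b::real_vector"
  shows "(\<Sum>x\<in>UNIV. \<Sum>e\<in>steps. (\<pi> x * rs x e) *\<^sub>R g (x + to_torus e)) =
    (\<Sum>x\<in>UNIV. (\<pi> x * (\<Sum>e\<in>steps. r x e)) *\<^sub>R g x)"
proof -
  have "(\<Sum>x\<in>UNIV. \<Sum>e\<in>steps. (\<pi> x * rs x e) *\<^sub>R g (x + to_torus e)) =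
      (\<Sum>e\<in>steps. \<Sum>x\<in>UNIV. (\<pi> (x + to_torus e) * r (x + to_torus e) (- e)) *\<^sub>R g (x + to_torus e))"
    by (simp add: pi_rs sum.swap[of _ steps])
  also have "\<dots> = (\<Sum>e\<in>steps. \<Sum>x\<in>UNIV. (\<pi> x * r x (- e)) *\<^sub>R g x)"
    by (intro sum.cong refl sum_torus_shift[where g = "\<lambda>x. (\<pi> x * r x (- _)) *\<^sub>R g x"])
  also have "\<dots> = (\<Sum>x\<in>UNIV. \<Sum>e\<in>steps. (\<pi> x * r x (- e)) *\<^sub>R g x)"
    by (rule sum.swap)
  also have "\<dots> = (\<Sum>x\<in>UNIV. \<Sum>e\<in>steps. (\<pi> x * r x e) *\<^sub>R g x)"
    by (intro sum.cong refl sum_steps_uminus[where g = "\<lambda>e. (\<pi> _ * r _ e) *\<^sub>R g _"])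
  finally show ?thesis by (simp add: sum_distrib_left scaleR_sum_left)
qed

text \<open>The value type is left general so that one operator serves real densities and complex
  amplitudes.\<close>

definition Lstar :: "(('n, 'd) torus \<Rightarrow> 'b::real_vector) \<Rightarrow> ('n, 'd) torus \<Rightarrow> 'b" where
  "Lstar u x = (\<Sum>e\<in>steps. rs x e *\<^sub>R (u (x + to_torus e) - u x))"

lemma sum_pi_Lstar: "(\<Sum>x\<in>UNIV. \<pi> x *\<^sub>R Lstar u x) = 0"
proof -
  have "(\<Sum>x\<in>UNIV. \<pi> x *\<^sub>R Lstar u x) =
     (\<Sum>x\<in>UNIV. \<Sum>e\<in>steps. (\<pi> x * rs x e) *\<^sub>R u (x + to_torus e)) -
     (\<Sum>x\<in>UNIV. (\<pi> x * (\<Sum>e\<in>steps. rs x e)) *\<^sub>R u x)"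
    by (simp add: Lstar_def scaleR_sum_right scaleR_diff_right sum_subtractf sum_distrib_left scaleR_sum_left)
  then show ?thesis by (simp add: sum_rs_shift sum_rs)
qed

definition dirichlet :: "(('n, 'd) torus \<Rightarrow> real) \<Rightarrow> real" where
  "dirichlet u = (\<Sum>x\<in>UNIV. \<Sum>e\<in>steps. \<pi> x * rs x e * (u (x + to_torus e) - u x)\<^sup>2)"

lemma dirichlet_scale: "dirichlet (\<lambda>x. c * u x) = c\<^sup>2 * dirichlet u"
  by (simp add: dirichlet_def sum_distrib_left right_diff_distrib[symmetric] power_mult_distrib mult_ac)

text \<open>Since 2a(b - a) + (b - a)^2 = b^2 - a^2, adding the Dirichlet form to the left side
  gives the \<open>\<pi>\<close>-mean of \<open>Lstar\<close> applied to the square of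
  \<open>u\<close>, which vanishes by invariance.\<close>

lemma dirichlet_Lstar: "2 * (\<Sum>x\<in>UNIV. \<pi> x * (u x * Lstar u x)) = - dirichlet u"
proof -
  have "2 * (\<Sum>x\<in>UNIV. \<pi> x * (u x * Lstar u x)) + dirichlet u =
      (\<Sum>x\<in>UNIV. \<Sum>e\<in>steps. \<pi> x * rs x e * (2 * u x * (u (x + to_torus e) - u x) + (u (x + to_torus e) - u x)\<^sup>2))"
    by (simp add: dirichlet_def Lstar_def sum_distrib_left sum.distrib[symmetric] algebra_simps)
  also have "\<dots> = (\<Sum>x\<in>UNIV. \<pi> x *\<^sub>R Lstar (\<lambda>x. (u x)\<^sup>2) x)"
    by (simp add: Lstar_def sum_distrib_left power2_eq_square algebra_simps)
  also have "\<dots> = 0" by (rule sum_pi_Lstar)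
  finally show ?thesis by simp
qed

lemma dirichlet_eq_0_imp_const:
  assumes "dirichlet u = 0"
  shows "u x = u y"
proof (rule torus_connected[where Q = "\<lambda>x. u x = u y" and x = y])
  fix x :: "('n, 'd) torus" and e :: "int ^ 'd"
  assume x: "u x = u y" and e: "e \<in> steps"
  have nn: "0 \<le> \<pi> x * rs x e * (u (x + to_torus e) - u x)\<^sup>2" if "e \<in> steps" for x e
    using pi_pos[of x] rs_pos[OF that, of x] by simp
  have "(\<Sum>e\<in>steps. \<pi> x * rs x e * (u (x + to_torus e) - u x)\<^sup>2) = 0"
    using assms unfolding dirichlet_def by (subst (asm) sum_nonneg_eq_0_iff) (auto intro: nn sum_nonneg)
  then have "\<pi> x * rs x e * (u (x + to_torus e) - u x)\<^sup>2 = 0"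
    using e by (subst (asm) sum_nonneg_eq_0_iff) (auto intro: nn)
  then show "u (x + to_torus e) = u y"
    using x pi_pos[of x] rs_pos[OF e, of x] by simp
qed simp

text \<open>Compactness: on the unit sphere of the zero-mean functions the Dirichlet form is
  continuous and positive, so it has a minimum \<open>m > 0\<close>, and scaling extends the bound.
  The gap is \<open>m / 2\<close> because the Dirichlet form is twice the quadratic form of
  \<open>- Lstar\<close>; \<open>\<pi> \<le> 1\<close> replaces the Euclidean norm by the weighted
  one.\<close>

lemma spectral_gap:
  obtains g where "0 < g"
    "\<And>u. (\<Sum>x\<in>UNIV. \<pi> x * u x) = 0 \<Longrightarrow>
      (\<Sum>x\<in>UNIV. \<pi> x * (u x * Lstar u x)) \<le> - g * (\<Sum>x\<in>UNIV. \<pi> x * (u x)\<^sup>2)"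
proof -
  define K where "K = {w :: real ^ ('n, 'd) torus. norm w = 1 \<and> (\<Sum>x\<in>UNIV. \<pi> x * w $ x) = 0}"
  define E where "E w = dirichlet (\<lambda>x. w $ x)" for w :: "real ^ ('n, 'd) torus"
  have "\<exists>m>0. \<forall>w\<in>K. m \<le> E w"
  \<comment> \<open>\<open>K\<close> is empty for a torus with a single site; then any positive
    constant serves.\<close>
  proof (cases "K = {}")
    case False
    have "K = sphere 0 1 \<inter> {w. (\<Sum>x\<in>UNIV. \<pi> x * w $ x) = 0}"
      by (auto simp: K_def)
    moreover have "closed {w :: real ^ ('n, 'd) torus. (\<Sum>x\<in>UNIV. \<pi> x * w $ x) = 0}"
      by (intro closed_Collect_eq continuous_intros)
    ultimately have "compact K" by (simp add: compact_Int_closed)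
    moreover have "continuous_on K E"
      unfolding E_def dirichlet_def by (intro continuous_intros)
    ultimately obtain w where w: "w \<in> K" "\<forall>z\<in>K. E w \<le> E z"
      using continuous_attains_inf[OF _ False] by blast
    have "E w \<noteq> 0"
    proof
      assume "E w = 0"
      then have const: "w $ x = w $ 0" for x
        unfolding E_def by (rule dirichlet_eq_0_imp_const)
      have "(\<Sum>x\<in>UNIV. \<pi> x * w $ x) = w $ 0"
        by (subst const) (simp add: sum_distrib_right[symmetric] pi_sum)
      then have "w $ 0 = 0" using w(1) by (simp add: K_def)
      then have "w = 0" using const by (simp add: vec_eq_iff)
      then show False using w(1) by (simp add: K_def)
    qed
    moreover have "0 \<le> E w" unfolding E_def dirichlet_def
      by (intro sum_nonneg mult_nonneg_nonneg) (auto intro: less_imp_le pi_pos rs_pos)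
    ultimately show ?thesis using w(2) by (intro exI[of _ "E w"]) auto
  qed (auto intro: exI[of _ 1])
  then obtain m where m: "0 < m" "\<And>w. w \<in> K \<Longrightarrow> m \<le> E w" by blast
  have "(\<Sum>x\<in>UNIV. \<pi> x * (u x * Lstar u x)) \<le> - (m / 2) * (\<Sum>x\<in>UNIV. \<pi> x * (u x)\<^sup>2)"
    if mean: "(\<Sum>x\<in>UNIV. \<pi> x * u x) = 0" for u
  proof -
    define w where "w = (\<chi> x. u x)"
    have "m * (\<Sum>x\<in>UNIV. (u x)\<^sup>2) \<le> dirichlet u"
    proof (cases "w = 0")
      case True
      then have "u x = 0" for x by (simp add: w_def vec_eq_iff)
      then show ?thesis by (simp add: dirichlet_def)
    next
      case False
      have "(\<Sum>x\<in>UNIV. \<pi> x * (u x / norm w)) = 0"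
        using mean by (simp add: sum_divide_distrib[symmetric])
      then have "w /\<^sub>R norm w \<in> K"
        using False by (simp add: K_def w_def divide_inverse mult.commute)
      then have "m \<le> E (w /\<^sub>R norm w)" by (rule m)
      also have "\<dots> = dirichlet u / (norm w)\<^sup>2"
        using dirichlet_scale[of "inverse (norm w)" u]
        by (simp add: E_def w_def power_inverse divide_inverse mult.commute)
      finally have "m * (norm w)\<^sup>2 \<le> dirichlet u"
        using False by (simp add: field_simps)
      moreover have "(norm w)\<^sup>2 = (\<Sum>x\<in>UNIV. (u x)\<^sup>2)"
        by (simp add: norm_vec_def L2_set_def w_def sum_nonneg)
      ultimately show ?thesis by simp
    qed
    moreover have "m * (\<Sum>x\<in>UNIV. \<pi> x * (u x)\<^sup>2) \<le> m * (\<Sum>x\<in>UNIV. (u x)\<^sup>2)"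
      using m(1) by (intro mult_left_mono sum_mono) (auto intro: mult_left_le_one_le pi_le_1 pi_nonneg)
    ultimately show ?thesis using dirichlet_Lstar[of u] by simp
  qed
  then show ?thesis using m(1) by (intro that[of "m / 2"]) auto
qed

text \<open>The squared norm of \<open>w\<close> can only increase while it is below \<open>\<epsilon>\<^sup>2 / g\<^sup>2\<close>. Hence its maximum over a
  period obeys this bound, and so does its value at any later time.\<close>

lemma periodic_response_bound:
  "\<exists>K>0. \<forall>w F T \<epsilon>.
    (\<forall>t\<ge>0. \<forall>y. ((\<lambda>s. w s y) has_real_derivative Lstar (w t) y + F t y) (at t within {0..})) \<longrightarrow>
    (\<forall>t\<ge>0. \<forall>y. \<bar>F t y\<bar> \<le> \<epsilon>) \<longrightarrow> (\<forall>t\<ge>0. (\<Sum>x\<in>UNIV. \<pi> x * w t x) = 0) \<longrightarrow>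
    0 < T \<longrightarrow> w T = w 0 \<longrightarrow> (\<forall>t\<ge>0. \<forall>y. \<bar>w t y\<bar> \<le> K * \<epsilon>)"
proof -
  obtain g where g: "0 < g" and gap: "\<And>u. (\<Sum>x\<in>UNIV. \<pi> x * u x) = 0 \<Longrightarrow>
      (\<Sum>x\<in>UNIV. \<pi> x * (u x * Lstar u x)) \<le> - g * (\<Sum>x\<in>UNIV. \<pi> x * (u x)\<^sup>2)"
    using spectral_gap by blast
  define m where "m = Min (range \<pi>)"
  have m: "0 < m" "m \<le> \<pi> x" for x
    unfolding m_def by (auto intro: pi_pos)
  have bound: "\<bar>w t y\<bar> \<le> 1 / (g * sqrt m) * \<epsilon>"
    if deriv: "\<And>t y. 0 \<le> t \<Longrightarrow> ((\<lambda>s. w s y) has_real_derivative Lstar (w t) y + F t y) (at t within {0..})"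
      and F: "\<And>t y. 0 \<le> t \<Longrightarrow> \<bar>F t y\<bar> \<le> \<epsilon>"
      and mean: "\<And>t. 0 \<le> t \<Longrightarrow> (\<Sum>x\<in>UNIV. \<pi> x * w t x) = 0"
      and T: "0 < T" "w T = w 0" and t: "0 \<le> t"
    for w F T \<epsilon> t y
  proof -
    define \<phi> where "\<phi> t = (\<Sum>x\<in>UNIV. \<pi> x * (w t x)\<^sup>2)" for t
    define D where "D t = (\<Sum>x\<in>UNIV. \<pi> x * (2 * w t x * (Lstar (w t) x + F t x)))" for t
    have \<epsilon>: "0 \<le> \<epsilon>" using F[of 0 undefined] by simp
    have d\<phi>: "(\<phi> has_real_derivative D t) (at t within {0..})" if "0 \<le> t" for t
      unfolding \<phi>_def D_def by (auto intro!: derivative_eq_intros deriv that simp: algebra_simps)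
    have D_le: "D t \<le> - g * \<phi> t + \<epsilon>\<^sup>2 / g" if t: "0 \<le> t" for t
    proof -
      \<comment> \<open>Young's inequality with weight \<open>g\<close>: the source uses up half of
        the decay rate 2g given by the gap and leaves \<epsilon>^2 / g.\<close>
      have "2 * w t x * F t x \<le> g * (w t x)\<^sup>2 + \<epsilon>\<^sup>2 / g" for x
      proof -
        have "0 \<le> (g * w t x - F t x)\<^sup>2" by simp
        then have "2 * w t x * F t x * g \<le> (g * w t x)\<^sup>2 + (F t x)\<^sup>2"
          by (simp add: power2_eq_square algebra_simps)
        also have "\<dots> \<le> (g * w t x)\<^sup>2 + \<epsilon>\<^sup>2"
          using F[OF t, of x] by (intro add_left_mono) (simp add: abs_le_square_iff[symmetric])
        finally show ?thesis using g by (simp add: field_simps power2_eq_square)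
      qed
      then have "(\<Sum>x\<in>UNIV. \<pi> x * (2 * w t x * F t x)) \<le> (\<Sum>x\<in>UNIV. \<pi> x * (g * (w t x)\<^sup>2 + \<epsilon>\<^sup>2 / g))"
        by (intro sum_mono mult_left_mono pi_nonneg)
      also have "\<dots> = g * \<phi> t + \<epsilon>\<^sup>2 / g * (\<Sum>x\<in>UNIV. \<pi> x)"
        by (simp add: \<phi>_def sum_distrib_left sum_distrib_right sum_divide_distrib sum.distrib algebra_simps)
      finally have "(\<Sum>x\<in>UNIV. \<pi> x * (2 * w t x * F t x)) \<le> g * \<phi> t + \<epsilon>\<^sup>2 / g" by (simp add: pi_sum)
      moreover have "D t = 2 * (\<Sum>x\<in>UNIV. \<pi> x * (w t x * Lstar (w t) x)) + (\<Sum>x\<in>UNIV. \<pi> x * (2 * w t x * F t x))"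
        by (simp add: D_def sum_distrib_left sum.distrib[symmetric] algebra_simps)
      ultimately show ?thesis using gap[OF mean[OF t]] by (simp add: \<phi>_def)
    qed
    \<comment> \<open>A negative one-sided derivative at \<open>t\<close> would produce larger
      values just before \<open>t\<close>. The argument therefore looks into the past and concerns
      maxima at positive times.\<close>
    have at_max: "\<phi> t \<le> (\<epsilon> / g)\<^sup>2" if "0 < t" "\<And>s. 0 \<le> s \<Longrightarrow> s \<le> t \<Longrightarrow> \<phi> s \<le> \<phi> t" for t
    proof (rule ccontr)
      assume "\<not> \<phi> t \<le> (\<epsilon> / g)\<^sup>2"
      then have "\<epsilon>\<^sup>2 / g < g * \<phi> t" using g by (simp add: field_simps power2_eq_square)
      then have "D t < 0" using D_le[of t] that(1) by simp
      from has_real_derivative_neg_dec_left[OF d\<phi> this] that(1)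
      obtain d where d: "0 < d" "\<And>h. 0 < h \<Longrightarrow> t - h \<in> {0..} \<Longrightarrow> h < d \<Longrightarrow> \<phi> t < \<phi> (t - h)"
        by auto
      \<comment> \<open>The minimum with \<open>t\<close> keeps the earlier time in the
        half-line.\<close>
      have "\<phi> t < \<phi> (t - min (d / 2) t)" using d(1) that(1) by (intro d(2)) auto
      moreover have "\<phi> (t - min (d / 2) t) \<le> \<phi> t" using d(1) that(1) by (intro that(2)) auto
      ultimately show False by simp
    qed
    have cont: "continuous_on {0..b} \<phi>" for b
      by (rule continuous_on_subset[of "{0..}"])
        (auto intro!: has_field_derivative_imp_has_derivative has_derivative_continuous_on d\<phi>
          simp: has_field_derivative_def[symmetric])
    have attains: "\<exists>s\<in>{0..b}. \<forall>u\<in>{0..b}. \<phi> u \<le> \<phi> s" if "0 \<le> b" for b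
      using continuous_attains_sup[of "{0..b}" \<phi>] cont that by auto
    have zero: "\<phi> 0 \<le> (\<epsilon> / g)\<^sup>2"
    proof -
      obtain s where s: "s \<in> {0..T}" "\<forall>u\<in>{0..T}. \<phi> u \<le> \<phi> s"
        using attains[of T] T(1) by auto
      have TT: "\<phi> T = \<phi> 0" using T(2) by (simp add: \<phi>_def)
      \<comment> \<open>A maximum over the period attained at time 0 has no past; periodicity moves
        it to \<open>T\<close> with the same value.\<close>
      define s' where "s' = (if s = 0 then T else s)"
      have "\<phi> s' \<le> (\<epsilon> / g)\<^sup>2"
        by (rule at_max) (use s T(1) TT in \<open>auto simp: s'_def\<close>)
      moreover have "\<phi> 0 \<le> \<phi> s'" using s T TT by (auto simp: s'_def)
      ultimately show ?thesis by simp
    qed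
    have "\<phi> t \<le> (\<epsilon> / g)\<^sup>2"
    proof -
      obtain s where s: "s \<in> {0..t}" "\<forall>u\<in>{0..t}. \<phi> u \<le> \<phi> s"
        using attains[OF t] by auto
      have "\<phi> s \<le> (\<epsilon> / g)\<^sup>2"
        by (cases "s = 0") (use zero s in \<open>auto intro!: at_max\<close>)
      then show ?thesis using s(2) t by (auto intro: order_trans)
    qed
    \<comment> \<open>The lower bound \<open>m\<close> of \<open>\<pi>\<close> converts the weighted
      norm into a pointwise bound; this is the factor \<open>1 / sqrt m\<close> in the
      constant.\<close>
    moreover have "m * (w t y)\<^sup>2 \<le> \<phi> t"
    proof -
      have "m * (w t y)\<^sup>2 \<le> \<pi> y * (w t y)\<^sup>2" by (intro mult_right_mono m) auto
      also have "\<dots> \<le> \<phi> t" unfolding \<phi>_def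
        by (rule member_le_sum) (auto simp: pi_nonneg)
      finally show ?thesis .
    qed
    ultimately have "m * (w t y)\<^sup>2 \<le> (\<epsilon> / g)\<^sup>2" by linarith
    then have "(w t y)\<^sup>2 \<le> (\<epsilon> / g)\<^sup>2 / m" using m(1) by (simp only: pos_le_divide_eq mult.commute)
    also have "\<dots> = (1 / (g * sqrt m) * \<epsilon>)\<^sup>2"
      using m(1) by (simp add: power_divide power_mult_distrib)
    finally show ?thesis
      using \<epsilon> g m(1) by (subst (asm) abs_le_square_iff[symmetric]) simp
  qed
  have "0 < 1 / (g * sqrt m)" using g m(1) by simp
  then show ?thesis
  proof (intro exI[of _ "1 / (g * sqrt m)"] conjI allI impI)
    fix w F :: "real \<Rightarrow> ('n, 'd) torus \<Rightarrow> real" and T \<epsilon> t :: real and y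
    assume "\<forall>t\<ge>0. \<forall>y. ((\<lambda>s. w s y) has_real_derivative Lstar (w t) y + F t y) (at t within {0..})"
      "\<forall>t\<ge>0. \<forall>y. \<bar>F t y\<bar> \<le> \<epsilon>" "\<forall>t\<ge>0. (\<Sum>x\<in>UNIV. \<pi> x * w t x) = 0"
      "0 < T" "w T = w 0" "0 \<le> t"
    then show "\<bar>w t y\<bar> \<le> 1 / (g * sqrt m) * \<epsilon>"
      by (intro bound[of w F \<epsilon> T t y]) (simp_all only:)
  qed
qed

end

section \<open>Operator exponentials\<close>

locale finite_operator =
  fixes A :: "('s::finite \<Rightarrow> complex) \<Rightarrow> 's \<Rightarrow> complex" and a :: "'s \<Rightarrow> 's \<Rightarrow> complex"
  assumes A: "A f x = (\<Sum>y\<in>UNIV. a x y * f y)"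
begin

text \<open>Summing all kernel entries crudely bounds the operator norm for the l1 norm; geometric
  growth of the powers is all that the exponential series asks for.\<close>

lemma pow_bound: "(\<Sum>x\<in>UNIV. norm ((A ^^ n) f x)) \<le> (\<Sum>x\<in>UNIV. \<Sum>y\<in>UNIV. norm (a x y)) ^ n * (\<Sum>x\<in>UNIV. norm (f x))"
proof (induction n)
  case (Suc n)
  define K where "K = (\<Sum>x\<in>UNIV. \<Sum>y\<in>UNIV. norm (a x y))"
  define B where "B = (\<Sum>x\<in>UNIV. norm ((A ^^ n) f x))"
  have "(\<Sum>x\<in>UNIV. norm ((A ^^ Suc n) f x)) \<le> (\<Sum>x\<in>UNIV. \<Sum>y\<in>UNIV. norm (a x y) * B)"
  proof (rule sum_mono)
    fix x
    have "norm ((A ^^ Suc n) f x) \<le> (\<Sum>y\<in>UNIV. norm (a x y * (A ^^ n) f y))"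
      by (simp add: A norm_sum)
    also have "\<dots> \<le> (\<Sum>y\<in>UNIV. norm (a x y) * B)"
      unfolding norm_mult B_def by (intro sum_mono mult_left_mono member_le_sum) auto
    finally show "norm ((A ^^ Suc n) f x) \<le> (\<Sum>y\<in>UNIV. norm (a x y) * B)" .
  qed
  also have "\<dots> = K * B" by (simp add: K_def sum_distrib_right)
  also have "\<dots> \<le> K * (K ^ n * (\<Sum>x\<in>UNIV. norm (f x)))"
    using Suc by (intro mult_left_mono) (auto simp: K_def B_def intro!: sum_nonneg)
  finally show ?case by (simp add: K_def mult_ac)
qed simp

lemma summable_pow: "summable (\<lambda>n. (A ^^ n) f x / fact n * z ^ n)"
proof (rule summable_comparison_test')
  define K where "K = (\<Sum>x\<in>UNIV. \<Sum>y\<in>UNIV. norm (a x y))"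
  define B where "B = (\<Sum>x\<in>UNIV. norm (f x))"
  show "summable (\<lambda>n. B * (inverse (fact n) * (K * norm z) ^ n))"
    by (intro summable_mult summable_exp)
  fix n :: nat
  have "norm ((A ^^ n) f x) \<le> K ^ n * B"
    using pow_bound[where n = n and f = f] unfolding K_def B_def
    by (intro order_trans[OF member_le_sum[of x UNIV "\<lambda>x. norm ((A ^^ n) f x)"]]) auto
  then have "norm ((A ^^ n) f x) * norm z ^ n / fact n \<le> K ^ n * B * norm z ^ n / fact n"
    by (intro divide_right_mono mult_right_mono) auto
  then show "norm ((A ^^ n) f x / fact n * z ^ n) \<le> B * (inverse (fact n) * (K * norm z) ^ n)"
    by (simp add: norm_mult norm_divide norm_power norm_inverse power_mult_distrib divide_inverse mult_ac)
qed

lemma exp_op_eq: "exp_op A s f x = (\<Sum>n. (A ^^ n) f x / fact n * complex_of_real (- s) ^ n)"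
  by (simp add: exp_op_def field_simps)

lemma sum_suminf:
  "(\<Sum>y\<in>UNIV. c y * (\<Sum>n. (A ^^ n) f y / fact n * z ^ n)) =
    (\<Sum>n. (\<Sum>y\<in>UNIV. c y * (A ^^ n) f y) / fact n * z ^ n)"
proof -
  have "(\<lambda>n. \<Sum>y\<in>UNIV. c y * ((A ^^ n) f y / fact n * z ^ n)) sums
      (\<Sum>y\<in>UNIV. c y * (\<Sum>n. (A ^^ n) f y / fact n * z ^ n))"
    by (intro sums_sum sums_mult summable_sums summable_pow)
  then show ?thesis by (simp add: sums_iff sum_distrib_right sum_divide_distrib mult.assoc)
qed

lemma A_suminf:
  "A (\<lambda>y. \<Sum>n. (A ^^ n) f y / fact n * z ^ n) x = (\<Sum>n. (A ^^ Suc n) f x / fact n * z ^ n)"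
  by (simp only: A[of "\<lambda>y. \<Sum>n. (A ^^ n) f y / fact n * z ^ n"] A[of "(A ^^ _) f"]
      sum_suminf funpow.simps o_apply)

lemma exp_op_commute: "A (exp_op A s f) = exp_op A s (A f)"
proof
  fix x
  have "A (exp_op A s f) x = (\<Sum>n. (A ^^ Suc n) f x / fact n * complex_of_real (- s) ^ n)"
    unfolding exp_op_eq[abs_def] by (rule A_suminf)
  then show "A (exp_op A s f) x = exp_op A s (A f) x"
    by (simp only: exp_op_eq funpow_Suc_right o_apply)
qed

lemma exp_op_0: "exp_op A 0 f = f"
proof
  fix x
  have "exp_op A 0 f x = (\<Sum>n\<in>{0}. (A ^^ n) f x / fact n * complex_of_real (- 0) ^ n)"
    unfolding exp_op_eq by (rule suminf_finite) auto
  then show "exp_op A 0 f x = f x" by simp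
qed

text \<open>A power series in a complex variable can be differentiated termwise, and
  \<open>diffs\<close> raises the power of \<open>A\<close> in its coefficients by one; composing
  with the map from s to -s gives the sign.\<close>

lemma exp_op_deriv: "((\<lambda>s. exp_op A s f x) has_vector_derivative - A (exp_op A s f) x) (at s)"
proof -
  define c where "c n = (A ^^ n) f x / fact n" for n
  have "diffs c n = (A ^^ Suc n) f x / fact n" for n
    by (simp add: diffs_def c_def del: of_nat_Suc funpow.simps)
  moreover have "((\<lambda>z. \<Sum>n. c n * z ^ n) has_field_derivative (\<Sum>n. diffs c n * (complex_of_real (- s)) ^ n)) (at (complex_of_real (- s)))"
    by (rule termdiffs_strong_converges_everywhere) (simp only: c_def summable_pow)
  ultimately have "((\<lambda>z. \<Sum>n. c n * z ^ n) has_field_derivative A (exp_op A s f) x) (at (complex_of_real (- s)))"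
    unfolding exp_op_eq[abs_def] A_suminf by simp
  moreover have "((\<lambda>s. complex_of_real (- s)) has_vector_derivative - 1) (at s)"
    by (auto intro!: derivative_eq_intros)
  ultimately have "((\<lambda>z. \<Sum>n. c n * z ^ n) \<circ> (\<lambda>s. complex_of_real (- s)) has_vector_derivative - 1 * A (exp_op A s f) x) (at s)"
    by (intro field_vector_diff_chain_at)
  then show ?thesis by (simp add: exp_op_eq c_def o_def)
qed

text \<open>Each term of the series is annihilated by the functional. With \<open>\<pi>\<close> in
  the place of \<open>c\<close>, the exponential preserves zero mean.\<close>

lemma sum_exp_op_eq_0:
  assumes "\<And>n. (\<Sum>x\<in>UNIV. c x * (A ^^ n) f x) = 0"
  shows "(\<Sum>x\<in>UNIV. c x * exp_op A s f x) = 0"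
  unfolding exp_op_eq sum_suminf assms by simp

text \<open>Dimension count: \<open>B\<close> is the same map on \<open>complex ^ 's\<close>, a
  finite-dimensional real vector space on which it is linear.\<close>

lemma inj_imp_bij:
  assumes "inj A"
  shows "bij A"
proof -
  define B where "B w = (\<chi> x. A (\<lambda>y. w $ y) x)" for w :: "complex ^ 's"
  have "linear B"
    by (rule linearI) (auto simp: B_def A vec_eq_iff algebra_simps sum.distrib scaleR_sum_right)
  moreover have "inj B"
  proof (rule injI)
    fix v w assume "B v = B w"
    then have "A (\<lambda>y. v $ y) = A (\<lambda>y. w $ y)" by (auto simp: B_def vec_eq_iff)
    then have "(\<lambda>y. v $ y) = (\<lambda>y. w $ y)" using assms by (simp add: inj_eq)
    then show "v = w" by (simp add: vec_eq_iff fun_eq_iff)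
  qed
  ultimately have "surj B" by (simp add: linear_injective_imp_surjective)
  have "\<exists>g. A g = f" for f
  proof -
    obtain w where "B w = (\<chi> x. f x)" using \<open>surj B\<close> by (metis surj_def)
    then have "A (\<lambda>y. w $ y) = f" by (simp add: B_def vec_eq_iff fun_eq_iff)
    then show ?thesis by blast
  qed
  then show ?thesis using assms by (metis bijI surjI)
qed

end

section \<open>The resolvent of the reversed generator\<close>

lemma jump_generator_eq:
  "jump_generator q f x = (\<Sum>e\<in>steps. of_real (q x e) * (f (x + to_torus e) - f x))"
  unfolding jump_generator_def by (rule sum_torus_rate)

context stationary_walk
begin

lemma jump_generator_rs: "jump_generator rs f = Lstar f"
  by (simp add: fun_eq_iff jump_generator_eq Lstar_def scaleR_conv_of_real)

lemma Re_Lstar: "Re (Lstar f x) = Lstar (\<lambda>x. Re (f x)) x"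
  by (simp add: Lstar_def)

lemma Im_Lstar: "Im (Lstar f x) = Lstar (\<lambda>x. Im (f x)) x"
  by (simp add: Lstar_def)

abbreviation resolved :: "real \<Rightarrow> (('n, 'd) torus \<Rightarrow> complex) \<Rightarrow> ('n, 'd) torus \<Rightarrow> complex" where
  "resolved \<omega> \<equiv> freq_minus \<omega> (jump_generator rs)"

abbreviation resolvent :: "real \<Rightarrow> (('n, 'd) torus \<Rightarrow> complex) \<Rightarrow> ('n, 'd) torus \<Rightarrow> complex" where
  "resolvent \<omega> \<equiv> inv_into UNIV (resolved \<omega>)"

lemma resolved_eq: "resolved \<omega> f x = \<i> * of_real \<omega> * f x - Lstar f x"
  by (simp add: freq_minus_def jump_generator_rs)

text \<open>On the diagonal the kernel contains the loop rate twice with opposite signs, so it is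
  right also when a step returns to its own site.\<close>

sublocale op: finite_operator "resolved \<omega>"
  "\<lambda>x y. (\<i> * of_real \<omega> + of_real (\<Sum>z\<in>UNIV. torus_rate rs x z)) * of_bool (y = x) - of_real (torus_rate rs x y)"
  for \<omega>
proof
  fix f :: "('n, 'd) torus \<Rightarrow> complex" and x
  have "(\<Sum>y\<in>UNIV. ((\<i> * of_real \<omega> + of_real (\<Sum>z\<in>UNIV. torus_rate rs x z)) * of_bool (y = x) - of_real (torus_rate rs x y)) * f y)
    = (\<Sum>y\<in>UNIV. if y = x then (\<i> * of_real \<omega> + of_real (\<Sum>z\<in>UNIV. torus_rate rs x z)) * f y else 0)
     - (\<Sum>y\<in>UNIV. of_real (torus_rate rs x y) * f y)"
    by (subst sum_subtractf[symmetric]) (auto intro!: sum.cong simp: algebra_simps)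
  also have "\<dots> = resolved \<omega> f x"
    by (simp add: sum.delta freq_minus_def jump_generator_def algebra_simps sum_distrib_left sum_subtractf)
  finally show "resolved \<omega> f x = (\<Sum>y\<in>UNIV. ((\<i> * of_real \<omega> + of_real (\<Sum>z\<in>UNIV. torus_rate rs x z)) * of_bool (y = x) - of_real (torus_rate rs x y)) * f y)"
    by simp
qed

text \<open>\<open>Lstar\<close> has zero \<open>\<pi>\<close>-mean, so only the frequency term is
  left. For \<omega> \<noteq> 0 an image of zero mean thus has only preimages of zero mean, which
  removes the constants from the kernel.\<close>

lemma sum_pi_resolved:
  "(\<Sum>x\<in>UNIV. of_real (\<pi> x) * resolved \<omega> f x) = \<i> * of_real \<omega> * (\<Sum>x\<in>UNIV. of_real (\<pi> x) * f x)"
proof -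
  have "(\<Sum>x\<in>UNIV. of_real (\<pi> x) * Lstar f x) = 0"
    using sum_pi_Lstar[of f] by (simp add: scaleR_conv_of_real)
  then show ?thesis
    by (simp add: resolved_eq sum_subtractf sum_distrib_left algebra_simps)
qed

lemma sum_pi_Re_Im:
  assumes "(\<Sum>x\<in>UNIV. of_real (\<pi> x) * f x) = 0"
  shows "(\<Sum>x\<in>UNIV. \<pi> x * Re (f x)) = 0" "(\<Sum>x\<in>UNIV. \<pi> x * Im (f x)) = 0"
proof -
  have "(\<Sum>x\<in>UNIV. \<pi> x * Re (f x)) = Re (\<Sum>x\<in>UNIV. of_real (\<pi> x) * f x)" by simp
  then show "(\<Sum>x\<in>UNIV. \<pi> x * Re (f x)) = 0" by (simp only: assms zero_complex.sel)
  have "(\<Sum>x\<in>UNIV. \<pi> x * Im (f x)) = Im (\<Sum>x\<in>UNIV. of_real (\<pi> x) * f x)" by simp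
  then show "(\<Sum>x\<in>UNIV. \<pi> x * Im (f x)) = 0" by (simp only: assms zero_complex.sel)
qed

text \<open>The difference \<open>u\<close> of two preimages is an eigenvector of
  \<open>Lstar\<close> for the eigenvalue i \<omega>, and has zero mean. The quadratic forms of its
  real and imaginary parts add up to zero, as the frequency terms are antisymmetric, while the gap
  makes the sum at most \<open>- g\<close> times the squared norm.\<close>

lemma inj_resolved:
  assumes "\<omega> \<noteq> 0"
  shows "inj (resolved \<omega>)"
proof (rule injI)
  fix f h assume eq: "resolved \<omega> f = resolved \<omega> h"
  define u where "u x = f x - h x" for x
  have u: "\<i> * of_real \<omega> * u x = Lstar u x" for x
    using fun_cong[OF eq, of x] by (simp add: resolved_eq u_def Lstar_def algebra_simps sum_subtractf sum.distrib)
  have "resolved \<omega> u x = 0" for x by (simp add: resolved_eq u)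
  then have mean: "(\<Sum>x\<in>UNIV. of_real (\<pi> x) * u x) = 0"
    using sum_pi_resolved[of \<omega> u] assms by simp
  note mean_Re = sum_pi_Re_Im(1)[OF mean] and mean_Im = sum_pi_Re_Im(2)[OF mean]
  obtain g where g: "0 < g" and gap: "\<And>u. (\<Sum>x\<in>UNIV. \<pi> x * u x) = 0 \<Longrightarrow>
      (\<Sum>x\<in>UNIV. \<pi> x * (u x * Lstar u x)) \<le> - g * (\<Sum>x\<in>UNIV. \<pi> x * (u x)\<^sup>2)"
    using spectral_gap by blast
  have "Lstar (\<lambda>x. Re (u x)) x = - \<omega> * Im (u x)" "Lstar (\<lambda>x. Im (u x)) x = \<omega> * Re (u x)" for x
    using arg_cong[OF u[of x], of Re] arg_cong[OF u[of x], of Im] by (simp_all add: Re_Lstar Im_Lstar)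
  then have "(\<Sum>x\<in>UNIV. \<pi> x * (Re (u x) * Lstar (\<lambda>x. Re (u x)) x)) + (\<Sum>x\<in>UNIV. \<pi> x * (Im (u x) * Lstar (\<lambda>x. Im (u x)) x)) = 0"
    by (simp add: sum.distrib[symmetric] algebra_simps)
  with gap[OF mean_Re] gap[OF mean_Im]
  have "g * ((\<Sum>x\<in>UNIV. \<pi> x * (Re (u x))\<^sup>2) + (\<Sum>x\<in>UNIV. \<pi> x * (Im (u x))\<^sup>2)) \<le> 0"
    by (simp add: algebra_simps)
  then have "(\<Sum>x\<in>UNIV. \<pi> x * (Re (u x))\<^sup>2) + (\<Sum>x\<in>UNIV. \<pi> x * (Im (u x))\<^sup>2) \<le> 0"
    using g by (auto simp: mult_le_0_iff)
  then have "(\<Sum>x\<in>UNIV. \<pi> x * ((Re (u x))\<^sup>2 + (Im (u x))\<^sup>2)) \<le> 0"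
    by (simp add: sum.distrib distrib_left)
  moreover have nn: "0 \<le> \<pi> x * ((Re (u x))\<^sup>2 + (Im (u x))\<^sup>2)" for x
    by (intro mult_nonneg_nonneg pi_nonneg) auto
  ultimately have "(\<Sum>x\<in>UNIV. \<pi> x * ((Re (u x))\<^sup>2 + (Im (u x))\<^sup>2)) = 0"
    by (intro antisym sum_nonneg) auto
  then have zero: "\<pi> x * ((Re (u x))\<^sup>2 + (Im (u x))\<^sup>2) = 0" for x
    using nn by (subst (asm) sum_nonneg_eq_0_iff) auto
  have "u x = 0" for x
    using zero[of x] pi_pos[of x] by (simp add: complex_eq_iff sum_power2_eq_zero_iff)
  then show "f = h" by (simp add: u_def fun_eq_iff)
qed

lemma resolved_resolvent: "\<omega> \<noteq> 0 \<Longrightarrow> resolved \<omega> (resolvent \<omega> f) = f"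
  using op.inj_imp_bij[OF inj_resolved] by (simp add: bij_is_surj surj_f_inv_f)

lemma resolventI: "\<omega> \<noteq> 0 \<Longrightarrow> resolved \<omega> h = f \<Longrightarrow> resolvent \<omega> f = h"
  using inj_resolved by (metis inv_f_f)

lemma sum_pi_resolvent:
  assumes "\<omega> \<noteq> 0" "(\<Sum>x\<in>UNIV. of_real (\<pi> x) * f x) = 0"
  shows "(\<Sum>x\<in>UNIV. of_real (\<pi> x) * resolvent \<omega> f x) = 0"
  using sum_pi_resolved[of \<omega> "resolvent \<omega> f"] assms by (simp add: resolved_resolvent)

text \<open>The frequency term rotates real into imaginary parts and leaves the squared norm
  unchanged, so the gap alone governs its decay, at rate 2g. The rate serves all frequencies and all
  zero-mean \<open>f\<close>; only \<open>C\<close> varies with them.\<close>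

lemma exp_op_decay:
  "\<exists>g>0. \<forall>\<omega> f. (\<Sum>x\<in>UNIV. of_real (\<pi> x) * f x) = 0 \<longrightarrow>
    (\<exists>C. \<forall>s\<ge>0. \<forall>x. norm (exp_op (resolved \<omega>) s f x) \<le> C * exp (- g * s))"
proof -
  obtain g where g: "0 < g" and gap: "\<And>u. (\<Sum>x\<in>UNIV. \<pi> x * u x) = 0 \<Longrightarrow>
      (\<Sum>x\<in>UNIV. \<pi> x * (u x * Lstar u x)) \<le> - g * (\<Sum>x\<in>UNIV. \<pi> x * (u x)\<^sup>2)"
    using spectral_gap by blast
  have "\<exists>C. \<forall>s\<ge>0. \<forall>x. norm (exp_op (resolved \<omega>) s f x) \<le> C * exp (- g * s)"
    if mean: "(\<Sum>x\<in>UNIV. of_real (\<pi> x) * f x) = 0" for \<omega> f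
  proof -
    define v where "v s = exp_op (resolved \<omega>) s f" for s
    have pow: "(\<Sum>x\<in>UNIV. of_real (\<pi> x) * (resolved \<omega> ^^ n) f x) = 0" for n
      by (induction n) (simp_all add: mean sum_pi_resolved)
    have mean_v: "(\<Sum>x\<in>UNIV. of_real (\<pi> x) * v s x) = 0" for s
      unfolding v_def by (rule op.sum_exp_op_eq_0[OF pow])
    note mean_Re = sum_pi_Re_Im(1)[OF mean_v] and mean_Im = sum_pi_Re_Im(2)[OF mean_v]
    have dv: "((\<lambda>s. v s x) has_vector_derivative - resolved \<omega> (v s) x) (at s)" for s x
      unfolding v_def by (rule op.exp_op_deriv)
    have dRe: "((\<lambda>s. Re (v s x)) has_real_derivative \<omega> * Im (v s x) + Lstar (\<lambda>x. Re (v s x)) x) (at s)" for s x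
      using bounded_linear.has_vector_derivative[OF bounded_linear_Re dv[of x s]]
      by (simp add: has_real_derivative_iff_has_vector_derivative resolved_eq Re_Lstar add.commute)
    have dIm: "((\<lambda>s. Im (v s x)) has_real_derivative - \<omega> * Re (v s x) + Lstar (\<lambda>x. Im (v s x)) x) (at s)" for s x
      using bounded_linear.has_vector_derivative[OF bounded_linear_Im dv[of x s]]
      by (simp add: has_real_derivative_iff_has_vector_derivative resolved_eq Im_Lstar)
    define \<phi> where "\<phi> s = (\<Sum>x\<in>UNIV. \<pi> x * ((Re (v s x))\<^sup>2 + (Im (v s x))\<^sup>2))" for s
    \<comment> \<open>In \<open>D\<close> the two frequency contributions to the derivative have
      already cancelled.\<close>
    define D where "D s = 2 * ((\<Sum>x\<in>UNIV. \<pi> x * (Re (v s x) * Lstar (\<lambda>x. Re (v s x)) x)) +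
      (\<Sum>x\<in>UNIV. \<pi> x * (Im (v s x) * Lstar (\<lambda>x. Im (v s x)) x)))" for s
    have d\<phi>: "(\<phi> has_real_derivative D s) (at s)" for s
      unfolding \<phi>_def D_def
      by (rule dRe dIm derivative_eq_intros refl)+
        (simp add: sum_distrib_left sum.distrib[symmetric] algebra_simps)
    have D_le: "D s \<le> - 2 * g * \<phi> s" for s
      using gap[OF mean_Re[of s]] gap[OF mean_Im[of s]]
      by (simp add: D_def \<phi>_def sum.distrib algebra_simps)
    have decay: "\<phi> s \<le> \<phi> 0 * exp (- 2 * g * s)" if "0 \<le> s" for s
    proof -
      \<comment> \<open>Gronwall's inequality, in the form that this product does not
        increase.\<close>
      have "\<phi> s * exp (2 * g * s) \<le> \<phi> 0 * exp (2 * g * 0)"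
      proof (rule DERIV_nonpos_imp_nonincreasing[OF that])
        fix u
        have "((\<lambda>s. \<phi> s * exp (2 * g * s)) has_real_derivative (D u + 2 * g * \<phi> u) * exp (2 * g * u)) (at u)"
          by (rule d\<phi> derivative_eq_intros refl)+ (simp add: algebra_simps)
        moreover have "(D u + 2 * g * \<phi> u) * exp (2 * g * u) \<le> 0"
          using D_le[of u] by (intro mult_nonpos_nonneg) auto
        ultimately show "\<exists>y. ((\<lambda>s. \<phi> s * exp (2 * g * s)) has_real_derivative y) (at u) \<and> y \<le> 0"
          by blast
      qed
      then show ?thesis by (simp add: exp_minus field_simps)
    qed
    define m where "m = Min (range \<pi>)"
    have m: "0 < m" "m \<le> \<pi> x" for x
      unfolding m_def by (auto intro: pi_pos)
    have \<phi>0: "0 \<le> \<phi> 0" unfolding \<phi>_def by (intro sum_nonneg mult_nonneg_nonneg pi_nonneg) auto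
    have "norm (v s x) \<le> sqrt (\<phi> 0 / m) * exp (- g * s)" if "0 \<le> s" for s x
    proof -
      have "m * (norm (v s x))\<^sup>2 \<le> \<pi> x * ((Re (v s x))\<^sup>2 + (Im (v s x))\<^sup>2)"
        unfolding cmod_power2 by (intro mult_right_mono m) auto
      also have "\<dots> \<le> \<phi> s" unfolding \<phi>_def
        by (rule member_le_sum) (auto simp: pi_nonneg)
      finally have "(norm (v s x))\<^sup>2 \<le> \<phi> 0 * exp (- 2 * g * s) / m"
        using decay[OF that] m(1) by (simp add: field_simps)
      also have "\<dots> = (sqrt (\<phi> 0 / m) * exp (- g * s))\<^sup>2"
        using m(1) \<phi>0 by (simp add: power_mult_distrib exp_double[symmetric] mult_ac)
      finally show ?thesis
        by (rule power2_le_imp_le) (use \<phi>0 m(1) in auto)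
    qed
    then show ?thesis unfolding v_def by blast
  qed
  then show ?thesis using g by blast
qed

text \<open>The exponential commutes with the operator, so the negative of \<open>\<Phi> h\<close>
  is an antiderivative of \<open>\<Phi> f\<close> for the preimage \<open>h\<close> of
  \<open>f\<close>. As \<open>h\<close> again has zero mean, the boundary term at the upper end
  decays, and the one at 0 is the pairing with \<open>h\<close> itself.\<close>

lemma laplace_resolvent:
  assumes \<omega>: "\<omega> \<noteq> 0" and mean: "(\<Sum>x\<in>UNIV. of_real (\<pi> x) * f x) = 0"
  shows "((\<lambda>s. l2_inner \<pi> b (exp_op (resolved \<omega>) s f)) has_integral l2_inner \<pi> b (resolvent \<omega> f)) {0..}"
proof -
  obtain g where g: "0 < g" and decay: "\<And>\<omega> f. (\<Sum>x\<in>UNIV. of_real (\<pi> x) * f x) = 0 \<Longrightarrow>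
      \<exists>C. \<forall>s\<ge>0. \<forall>x. norm (exp_op (resolved \<omega>) s f x) \<le> C * exp (- g * s)"
    using exp_op_decay by blast
  define h where "h = resolvent \<omega> f"
  have Ah: "resolved \<omega> h = f" unfolding h_def by (rule resolved_resolvent[OF \<omega>])
  define \<Phi> where "\<Phi> f s = l2_inner \<pi> b (exp_op (resolved \<omega>) s f)" for f s
  have bound: "\<exists>C. \<forall>s\<ge>0. norm (\<Phi> f s) \<le> C * exp (- g * s)"
    if mean: "(\<Sum>x\<in>UNIV. of_real (\<pi> x) * f x) = 0" for f
  proof -
    obtain C where C: "\<And>s x. 0 \<le> s \<Longrightarrow> norm (exp_op (resolved \<omega>) s f x) \<le> C * exp (- g * s)"
      using decay[OF mean] by blast
    have "norm (\<Phi> f s) \<le> (\<Sum>x\<in>UNIV. norm (of_real (\<pi> x) * cnj (b x)) * C) * exp (- g * s)" if "0 \<le> s" for s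
    proof -
      have "norm (\<Phi> f s) \<le> (\<Sum>x\<in>UNIV. norm (of_real (\<pi> x) * cnj (b x)) * (C * exp (- g * s)))"
        unfolding \<Phi>_def l2_inner_def
        unfolding norm_mult by (intro sum_norm_le) (simp only: norm_mult, intro mult_left_mono C that, simp)
      then show ?thesis by (simp only: sum_distrib_right mult.assoc)
    qed
    then show ?thesis by blast
  qed
  have deriv: "((\<lambda>s. - \<Phi> h s) has_vector_derivative \<Phi> f s) (at s within S)" for s S
  proof -
    have "((\<lambda>s. exp_op (resolved \<omega>) s h x) has_vector_derivative - exp_op (resolved \<omega>) s f x) (at s within S)" for x
      using op.exp_op_deriv[of \<omega> h x s] by (simp add: op.exp_op_commute Ah has_vector_derivative_at_within)
    then have "((\<lambda>s. - (\<Sum>x\<in>UNIV. of_real (\<pi> x) * cnj (b x) * exp_op (resolved \<omega>) s h x)) has_vector_derivative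
        - (\<Sum>x\<in>UNIV. of_real (\<pi> x) * cnj (b x) * - exp_op (resolved \<omega>) s f x)) (at s within S)"
      by (intro has_vector_derivative_minus has_vector_derivative_sum has_vector_derivative_mult_right)
    then show ?thesis by (simp add: \<Phi>_def l2_inner_def sum_negf)
  qed
  have int: "(\<Phi> f has_integral (\<Phi> h 0 - \<Phi> h (real k))) {0..real k}" for k :: nat
    using fundamental_theorem_of_calculus[OF _ deriv, of 0 "real k"] by simp
  \<comment> \<open>Extension by zero puts all truncated integrals on the same half-line, where
    dominated convergence applies.\<close>
  define F where "F k s = (if s \<in> {0..real k} then \<Phi> f s else 0)" for k :: nat and s
  have F: "(F k has_integral (\<Phi> h 0 - \<Phi> h (real k))) {0..}" for k
    unfolding F_def by (subst has_integral_restrict) (auto intro: int)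
  obtain C where C: "\<And>s. 0 \<le> s \<Longrightarrow> norm (\<Phi> f s) \<le> C * exp (- g * s)"
    using bound[OF mean] by blast
  have C0: "0 \<le> C" using C[of 0] norm_ge_zero[of "\<Phi> f 0"] by (simp del: norm_ge_zero)
  obtain C' where C': "\<And>s. 0 \<le> s \<Longrightarrow> norm (\<Phi> h s) \<le> C' * exp (- g * s)"
    using bound[of h] sum_pi_resolvent[OF \<omega> mean] unfolding h_def by blast
  have F_int: "F k integrable_on {0..}" for k using F by (rule has_integral_integrable)
  have dom_int: "(\<lambda>s. C * exp (- g * s)) integrable_on {0..}"
    by (rule has_integral_integrable[OF has_integral_mult_right[OF has_integral_exp_minus_to_infinity[OF g]]])
  have F_le: "norm (F k s) \<le> C * exp (- g * s)" if "s \<in> {0..}" for k s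
    using C[of s] C0 that by (auto simp: F_def)
  have F_lim: "(\<lambda>k. F k s) \<longlonglongrightarrow> \<Phi> f s" if "s \<in> {0..}" for s
  proof (rule tendsto_eventually)
    obtain K :: nat where "s \<le> real K" using real_arch_simple by blast
    then show "\<forall>\<^sub>F k in sequentially. F k s = \<Phi> f s"
      using that by (auto simp: F_def eventually_sequentially intro!: exI[of _ K])
  qed
  note conv = dominated_convergence[OF F_int dom_int F_le F_lim]
  have "(\<lambda>k. \<Phi> h (real k)) \<longlonglongrightarrow> 0"
  proof (rule Lim_null_comparison)
    show "\<forall>\<^sub>F k in sequentially. norm (\<Phi> h (real k)) \<le> C' * exp (- g * real k)"
      using C' by simp
    show "(\<lambda>k. C' * exp (- g * real k)) \<longlonglongrightarrow> 0"
      using g by real_asymp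
  qed
  then have "(\<lambda>k. \<Phi> h 0 - \<Phi> h (real k)) \<longlonglongrightarrow> \<Phi> h 0 - 0" by (intro tendsto_intros)
  then have "integral {0..} (\<Phi> f) = \<Phi> h 0"
    using LIMSEQ_unique[OF conv(2)] by (simp add: integral_unique[OF F])
  then have "(\<Phi> f has_integral \<Phi> h 0) {0..}"
    using conv(1) by (simp add: has_integral_iff)
  then show ?thesis unfolding \<Phi>_def op.exp_op_0 h_def .
qed

end

section \<open>The mean velocity of a lifted walk\<close>

lemma infsum_lattice_rate_into:
  fixes r :: "('n::finite, 'd::finite) rates" and g :: "int ^ 'd \<Rightarrow> real"
  shows "(\<Sum>\<^sub>\<infinity>z. g z * lattice_rate r z y) = (\<Sum>e\<in>steps. g (y - e) * r (to_torus (y - e)) e)"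
proof -
  have "(\<Sum>\<^sub>\<infinity>z. g z * lattice_rate r z y) = (\<Sum>\<^sub>\<infinity>z\<in>(\<lambda>e. y - e) ` steps. g z * lattice_rate r z y)"
    by (rule infsum_cong_neutral) (auto simp: lattice_rate_def image_iff intro: bexI[of _ "y - _"])
  also have "\<dots> = (\<Sum>e\<in>steps. g (y - e) * r (to_torus (y - e)) e)"
    by (subst infsum_finite) (auto simp: sum.reindex inj_on_def lattice_rate_def)
  finally show ?thesis .
qed

lemma infsum_lattice_rate_out:
  fixes r :: "('n::finite, 'd::finite) rates"
  shows "(\<Sum>\<^sub>\<infinity>z. lattice_rate r y z) = (\<Sum>e\<in>steps. r (to_torus y) e)"
proof -
  have "(\<Sum>\<^sub>\<infinity>z. lattice_rate r y z) = (\<Sum>\<^sub>\<infinity>z\<in>(\<lambda>e. y + e) ` steps. lattice_rate r y z)"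
    by (rule infsum_cong_neutral) (auto simp: lattice_rate_def image_iff intro: bexI[of _ "_ - y"])
  also have "\<dots> = (\<Sum>e\<in>steps. r (to_torus y) e)"
    by (subst infsum_finite) (auto simp: sum.reindex inj_on_def lattice_rate_def)
  finally show ?thesis .
qed

text \<open>This allows the starting points to be listed by a bijection from the natural numbers, so
  that laws become ordinary series.\<close>

lemma infinite_lattice: "infinite (UNIV :: (int ^ 'd::finite) set)"
proof
  assume "finite (UNIV :: (int ^ 'd) set)"
  moreover have "inj (\<lambda>k. \<chi> i. k :: int ^ 'd)" by (rule injI) (simp add: vec_eq_iff)
  ultimately have "finite (UNIV :: int set)" by (metis finite_imageD finite_subset subset_UNIV)
  then show False by simp
qed

lemma markov_process_two_times:
  assumes "markov_process M P X" "0 \<le> s" "s \<le> t"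
  shows "measure M {w \<in> space M. X s w = x \<and> X t w = y} = measure M {w \<in> space M. X s w = x} * P s t x y"
proof -
  define tt where "tt i = (if i = 0 then s else t)" for i :: nat
  define aa where "aa i = (if i = 0 then x else y)" for i :: nat
  have "measure M {w \<in> space M. \<forall>i\<le>1. X (tt i) w = aa i} =
      measure M {w \<in> space M. X (tt 0) w = aa 0} * (\<Prod>i<1. P (tt i) (tt (Suc i)) (aa i) (aa (Suc i)))"
    by (rule assms(1)[unfolded markov_process_def, THEN conjunct2, THEN conjunct2,
        THEN spec[of _ 1], THEN spec[of _ tt], THEN spec[of _ aa], THEN mp])
      (use assms(2,3) in \<open>auto simp: tt_def\<close>)
  moreover have "{w \<in> space M. \<forall>i\<le>1. X (tt i) w = aa i} = {w \<in> space M. X s w = x \<and> X t w = y}"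
    unfolding One_nat_def by (auto simp: tt_def aa_def le_Suc_eq all_conj_distrib)
  ultimately show ?thesis by (simp add: tt_def aa_def)
qed

lemma prob_sums_countable:
  assumes "prob_space M" "Z \<in> measurable M (count_space (UNIV :: 's set))"
    and "bij (x :: nat \<Rightarrow> 's)" and A: "A \<in> sets M"
  shows "(\<lambda>n. measure M {w \<in> A. Z w = x n}) sums measure M A"
proof -
  interpret prob_space M by fact
  note [measurable] = assms(2)
  have "{w \<in> A. Z w = x n} = A \<inter> {w \<in> space M. Z w = x n}" for n
    using sets.sets_into_space[OF A] by auto
  then have "{w \<in> A. Z w = x n} \<in> sets M" for n
    using A by auto
  moreover have "disjoint_family (\<lambda>n. {w \<in> A. Z w = x n})"
    using bij_is_inj[OF assms(3)] by (auto simp: disjoint_family_on_def inj_def)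
  moreover have "(\<Union>n. {w \<in> A. Z w = x n}) = A"
    using bij_is_surj[OF assms(3)] by (auto simp: surj_def)
  ultimately show ?thesis
    using finite_measure_UNION[of "\<lambda>n. {w \<in> A. Z w = x n}"] by auto
qed

lemma finite_lattice_ball: "finite {y :: int ^ 'd::finite. norm (real_vec y) \<le> c}"
proof (rule finite_subset)
  define k where "k = \<lceil>c\<rceil>"
  show "{y :: int ^ 'd. norm (real_vec y) \<le> c} \<subseteq> vec_lambda ` (PiE UNIV (\<lambda>_. {-k..k}))"
  proof
    fix y :: "int ^ 'd" assume y: "y \<in> {y. norm (real_vec y) \<le> c}"
    have "y $ i \<in> {-k..k}" for i
    proof -
      have "\<bar>real_vec y $ i\<bar> \<le> c" using component_le_norm_cart[of "real_vec y" i] y by simp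
      then have "\<bar>real_of_int (y $ i)\<bar> \<le> of_int k" unfolding k_def
        by (simp add: order_trans[OF _ le_of_int_ceiling])
      then show ?thesis by (simp add: abs_le_iff)
    qed
    then have "vec_nth y \<in> PiE UNIV (\<lambda>_. {-k..k})" by (auto simp: PiE_def)
    then show "y \<in> vec_lambda ` (PiE UNIV (\<lambda>_. {-k..k}))"
      by (rule image_eqI[rotated]) simp
  qed
  show "finite (vec_lambda ` (PiE UNIV (\<lambda>_. {-k..k})) :: (int ^ 'd) set)"
    by (intro finite_imageI finite_PiE) auto
qed

lemma has_vector_derivative_vec:
  fixes F :: "real \<Rightarrow> real ^ 'd::finite"
  assumes "\<And>j. ((\<lambda>s. F s $ j) has_real_derivative D $ j) (at t within S)"
  shows "(F has_vector_derivative D) (at t within S)"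
proof -
  have "((\<lambda>s. \<Sum>j\<in>UNIV. (F s $ j) *\<^sub>R axis j 1) has_vector_derivative (\<Sum>j\<in>UNIV. (D $ j) *\<^sub>R (axis j 1 :: real ^ 'd))) (at t within S)"
    by (intro has_vector_derivative_sum) (auto intro!: derivative_eq_intros assms)
  moreover have "(\<Sum>j\<in>UNIV. (x $ j) *\<^sub>R (axis j 1 :: real ^ 'd)) = x" for x :: "real ^ 'd"
    using basis_expansion[of x] by (simp add: scalar_mult_eq_scaleR)
  ultimately show ?thesis by simp
qed

text \<open>The uniform bound \<open>R\<close> keeps the drift of any test function with unit
  increments bounded, wherever the walk is on the infinite lattice.\<close>

locale bounded_lift =
  fixes M :: "'w measure" and q :: "real \<Rightarrow> ('n::finite, 'd::finite) rates"
    and X :: "real \<Rightarrow> 'w \<Rightarrow> ('n, 'd) torus" and Y :: "real \<Rightarrow> 'w \<Rightarrow> int ^ 'd" and R :: real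
  assumes lift: "lifted_walk M q X Y"
    and q_nonneg: "0 \<le> t \<Longrightarrow> e \<in> steps \<Longrightarrow> 0 \<le> q t x e"
    and q_le: "0 \<le> t \<Longrightarrow> e \<in> steps \<Longrightarrow> q t x e \<le> R"
begin

sublocale prob_space M
  using lift by (auto simp: lifted_walk_def markov_process_def)

lemma measurable_Y: "0 \<le> t \<Longrightarrow> Y t \<in> measurable M (count_space UNIV)"
  using lift by (auto simp: lifted_walk_def markov_process_def)

lemma borel_measurable_Y: "0 \<le> t \<Longrightarrow> (\<lambda>w. g (Y t w)) \<in> borel_measurable M"
  by (rule measurable_compose[OF measurable_Y]) auto

lemma to_torus_Y: "0 \<le> t \<Longrightarrow> w \<in> space M \<Longrightarrow> to_torus (Y t w) = X t w"
  using lift by (auto simp: lifted_walk_def)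

definition law :: "real \<Rightarrow> int ^ 'd \<Rightarrow> real" where
  "law t y = prob {w \<in> space M. Y t w = y}"

text \<open>A common bound on the exit rates of all sites at all times, not one of these
  rates.\<close>

definition exit_rate :: real where
  "exit_rate = of_nat (card (steps :: (int ^ 'd) set)) * R"

lemma sum_rates_bound:
  assumes "0 \<le> t" "\<And>e. e \<in> steps \<Longrightarrow> \<bar>a e\<bar> \<le> 1"
  shows "\<bar>\<Sum>e\<in>steps. a e * q t (b e) e\<bar> \<le> exit_rate"
proof -
  have "\<bar>\<Sum>e\<in>steps. a e * q t (b e) e\<bar> \<le> (\<Sum>e\<in>(steps :: (int ^ 'd) set). R)"
  proof (rule order_trans[OF sum_abs], rule sum_mono)
    fix e :: "int ^ 'd" assume e: "e \<in> steps"
    have "\<bar>a e\<bar> * \<bar>q t (b e) e\<bar> \<le> 1 * R"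
      using assms e q_nonneg[OF assms(1) e, of "b e"] q_le[OF assms(1) e, of "b e"]
      by (intro mult_mono) auto
    then show "\<bar>a e * q t (b e) e\<bar> \<le> R" by (simp add: abs_mult)
  qed
  then show ?thesis by (simp add: exit_rate_def)
qed

text \<open>The law of the walk is a series over the starting points, differentiable termwise because the
  terms are dominated by \<open>law 0\<close> up to a constant.\<close>

lemma master_equation:
  assumes t: "0 \<le> t"
  shows "((\<lambda>s. law s y) has_real_derivative
    (\<Sum>e\<in>steps. law t (y - e) * q t (to_torus (y - e)) e) - law t y * (\<Sum>e\<in>steps. q t (to_torus y) e))
    (at t within {0..})"
proof -
  obtain P where trans: "transition_function (\<lambda>t. lattice_rate (q t)) P" and markov: "markov_process M P Y"
    using lift by (auto simp: lifted_walk_def)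
  define x where "x = from_nat_into (UNIV :: (int ^ 'd) set)"
  have x: "bij x" unfolding x_def by (rule bij_betw_from_nat_into) (auto simp: infinite_lattice)
  define D where "D n t = (\<Sum>e\<in>steps. P 0 t (x n) (y - e) * q t (to_torus (y - e)) e) -
    P 0 t (x n) y * (\<Sum>e\<in>steps. q t (to_torus y) e)" for n t
  have P: "(\<forall>y. 0 \<le> P 0 t z y) \<and> (P 0 t z has_sum 1) UNIV \<and>
      (\<forall>y. ((\<lambda>u. P 0 u z y) has_real_derivative
        (\<Sum>\<^sub>\<infinity>z'. P 0 t z z' * lattice_rate (q t) z' y) - P 0 t z y * (\<Sum>\<^sub>\<infinity>z. lattice_rate (q t) y z))
        (at t within {0..}))" if "0 \<le> t" for t z
    by (rule trans[unfolded transition_function_def, THEN spec[of _ 0], THEN mp, OF order_refl,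
        THEN spec[of _ z], THEN conjunct2, THEN spec[of _ t], THEN mp, OF that])
  have P_deriv: "((\<lambda>s. P 0 s (x n) y) has_real_derivative D n t) (at t within {0..})" if "0 \<le> t" for n t
    using P[OF that, THEN conjunct2, THEN conjunct2, THEN spec[of _ y]]
    unfolding D_def infsum_lattice_rate_into infsum_lattice_rate_out .
  have P01: "0 \<le> P 0 t z y \<and> P 0 t z y \<le> 1" if "0 \<le> t" for t z y
  proof -
    have nn: "0 \<le> P 0 t z y" for y by (rule P[OF that, THEN conjunct1, THEN spec])
    have "(P 0 t z has_sum 1) UNIV" by (rule P[OF that, THEN conjunct2, THEN conjunct1])
    from has_sum_mono2[OF has_sum_finite[of "{y}" "P 0 t z"] this] nn
    have "sum (P 0 t z) {y} \<le> 1" by simp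
    then show ?thesis using nn by simp
  qed
  \<comment> \<open>Transition probabilities are at most 1, so inflow and outflow contribute one
    \<open>exit_rate\<close> each.\<close>
  have D_bound: "\<bar>D n t\<bar> \<le> 2 * exit_rate" if t: "0 \<le> t" for n t
  proof -
    have "\<bar>\<Sum>e\<in>steps. P 0 t (x n) (y - e) * q t (to_torus (y - e)) e\<bar> \<le> exit_rate"
      using P01[OF t] by (intro sum_rates_bound t) auto
    moreover have "\<bar>\<Sum>e\<in>steps. P 0 t (x n) y * q t (to_torus y) e\<bar> \<le> exit_rate"
      using P01[OF t] by (intro sum_rates_bound[where b = "\<lambda>_. to_torus y"] t) auto
    ultimately show ?thesis by (simp add: D_def sum_distrib_left)
  qed
  have law_sums: "(\<lambda>n. law 0 (x n) * P 0 t (x n) y) sums law t y" if t: "0 \<le> t" for t y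
  proof -
    note [measurable] = measurable_Y[OF t]
    have eq: "{w \<in> {w \<in> space M. Y t w = y}. Y 0 w = x n} = {w \<in> space M. Y 0 w = x n \<and> Y t w = y}" for n
      by auto
    show ?thesis
      using prob_sums_countable[OF prob_space_axioms measurable_Y x, of 0 "{w \<in> space M. Y t w = y}"]
      unfolding eq markov_process_two_times[OF markov order_refl t] law_def[symmetric]
      by simp
  qed
  have "summable (\<lambda>n. law 0 (x n))"
    using prob_sums_countable[OF prob_space_axioms measurable_Y x, of 0 "space M"]
    by (auto simp: law_def[symmetric] sums_iff)
  then have "uniform_limit {0..} (\<lambda>n t. \<Sum>i<n. law 0 (x i) * D i t) (\<lambda>t. \<Sum>i. law 0 (x i) * D i t) sequentially"
    using D_bound
    by (intro Weierstrass_m_test[where M = "\<lambda>n. law 0 (x n) * (2 * exit_rate)"] summable_mult2)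
      (auto simp: abs_mult law_def intro!: mult_left_mono)
  then have "\<exists>g. \<forall>t\<in>{0..}. (\<lambda>n. law 0 (x n) * P 0 t (x n) y) sums g t \<and>
      (g has_real_derivative (\<Sum>i. law 0 (x i) * D i t)) (at t within {0..})"
  proof (rule has_field_derivative_series[rotated 2])
    show "((\<lambda>t. law 0 (x n) * P 0 t (x n) y) has_real_derivative law 0 (x n) * D n t) (at t within {0..})"
      if "t \<in> {0..}" for n t
      using that by (intro DERIV_cmult P_deriv) simp
    show "summable (\<lambda>n. law 0 (x n) * P 0 0 (x n) y)"
      by (rule sums_summable[OF law_sums]) simp
  qed auto
  then obtain g where g: "\<And>t. 0 \<le> t \<Longrightarrow> (\<lambda>n. law 0 (x n) * P 0 t (x n) y) sums g t"
    "\<And>t. 0 \<le> t \<Longrightarrow> (g has_real_derivative (\<Sum>i. law 0 (x i) * D i t)) (at t within {0..})"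
    by auto
  have g_law: "g t = law t y" if "0 \<le> t" for t
    using g(1)[OF that] law_sums[OF that] by (rule sums_unique2)
  have deriv: "((\<lambda>s. law s y) has_real_derivative (\<Sum>i. law 0 (x i) * D i t)) (at t within {0..})"
    by (rule has_field_derivative_transform_within[OF g(2)[OF t] zero_less_one]) (use t g_law in auto)
  have D_sums: "(\<lambda>i. law 0 (x i) * D i t) sums
      ((\<Sum>e\<in>steps. law t (y - e) * q t (to_torus (y - e)) e) - law t y * (\<Sum>e\<in>steps. q t (to_torus y) e))"
  proof -
    have "(\<lambda>i. (\<Sum>e\<in>steps. (law 0 (x i) * P 0 t (x i) (y - e)) * q t (to_torus (y - e)) e) -
        (law 0 (x i) * P 0 t (x i) y) * (\<Sum>e\<in>steps. q t (to_torus y) e)) sums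
      ((\<Sum>e\<in>steps. law t (y - e) * q t (to_torus (y - e)) e) - law t y * (\<Sum>e\<in>steps. q t (to_torus y) e))"
      by (intro sums_diff sums_sum sums_mult2 law_sums t)
    then show ?thesis by (simp add: D_def right_diff_distrib sum_distrib_left mult.assoc)
  qed
  show ?thesis using deriv unfolding sums_unique[OF D_sums, symmetric] .
qed

lemma expectation_finite_support:
  assumes "0 \<le> t" "finite S" "\<And>y. y \<notin> S \<Longrightarrow> g y = 0"
  shows "expectation (\<lambda>w. g (Y t w)) = (\<Sum>y\<in>S. g y * law t y)"
proof -
  note [measurable] = measurable_Y[OF assms(1)]
  have "expectation (\<lambda>w. g (Y t w)) = expectation (\<lambda>w. \<Sum>y\<in>S. g y * indicator {w \<in> space M. Y t w = y} w)"
  proof (rule Bochner_Integration.integral_cong[OF refl])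
    fix w assume "w \<in> space M"
    then have "(\<Sum>y\<in>S. g y * indicator {w \<in> space M. Y t w = y} w) = (\<Sum>y\<in>S. if y = Y t w then g y else 0)"
      by (intro sum.cong) auto
    then show "g (Y t w) = (\<Sum>y\<in>S. g y * indicator {w \<in> space M. Y t w = y} w)"
      using assms by (simp add: sum.delta)
  qed
  also have "\<dots> = (\<Sum>y\<in>S. expectation (\<lambda>w. g y * indicator {w \<in> space M. Y t w = y} w))"
    by (rule Bochner_Integration.integral_sum) (auto intro!: integrable_mult_right integrable_real_indicator simp: less_top[symmetric])
  also have "\<dots> = (\<Sum>y\<in>S. g y * law t y)"
    by (simp add: law_def)
  finally show ?thesis .
qed

section \<open>Dynkin's formula for truncated observables\<close>

definition gen :: "real \<Rightarrow> (int ^ 'd \<Rightarrow> real) \<Rightarrow> int ^ 'd \<Rightarrow> real" where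
  "gen t f y = (\<Sum>e\<in>steps. (f (y + e) - f y) * q t (to_torus y) e)"

text \<open>Summation by parts: translating the inflow sum by a step moves the jump from the law to
  \<open>f\<close>. \<open>S'\<close> enlarges \<open>S\<close> by the sites from which one step
  leads into it, so it carries \<open>gen t f\<close> and keeps every sum finite.\<close>

lemma expectation_deriv:
  assumes t: "0 \<le> t" and S: "finite S" "\<And>y. y \<notin> S \<Longrightarrow> f y = 0"
  shows "((\<lambda>s. expectation (\<lambda>w. f (Y s w))) has_real_derivative expectation (\<lambda>w. gen t f (Y t w)))
    (at t within {0..})"
proof -
  define S' where "S' = S \<union> (\<Union>e\<in>steps. (\<lambda>y. y - e) ` S)"
  have S': "finite S'" "S \<subseteq> S'" using S by (auto simp: S'_def)
  have into: "(\<Sum>y\<in>S. f y * (law t (y - e) * q t (to_torus (y - e)) e)) =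
      (\<Sum>y\<in>S'. f (y + e) * q t (to_torus y) e * law t y)" if "e \<in> steps" for e
  proof -
    have "(\<Sum>y\<in>S. f y * (law t (y - e) * q t (to_torus (y - e)) e)) =
        (\<Sum>y\<in>(\<lambda>y. y - e) ` S. f (y + e) * q t (to_torus y) e * law t y)"
      by (subst sum.reindex) (auto simp: inj_on_def mult_ac)
    also have "\<dots> = (\<Sum>y\<in>S'. f (y + e) * q t (to_torus y) e * law t y)"
    proof (rule sum.mono_neutral_left)
      show "(\<lambda>y. y - e) ` S \<subseteq> S'" using that by (auto simp: S'_def)
      show "\<forall>i\<in>S' - (\<lambda>y. y - e) ` S. f (i + e) * q t (to_torus i) e * law t i = 0"
      proof
        fix i assume "i \<in> S' - (\<lambda>y. y - e) ` S"
        then have "i + e \<notin> S" by (auto simp: image_iff)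
        then show "f (i + e) * q t (to_torus i) e * law t i = 0" using S(2) by simp
      qed
    qed (rule S')
    finally show ?thesis .
  qed
  have out: "(\<Sum>y\<in>S. f y * (law t y * (\<Sum>e\<in>steps. q t (to_torus y) e))) =
      (\<Sum>y\<in>S'. f y * (law t y * (\<Sum>e\<in>steps. q t (to_torus y) e)))"
    using S S' by (intro sum.mono_neutral_left) auto
  have gen0: "gen t f y = 0" if "y \<notin> S'" for y
  proof -
    have "y + e \<notin> S" if "e \<in> steps" for e
      using that \<open>y \<notin> S'\<close> by (force simp: S'_def)
    moreover have "f y = 0" using that S' S(2) by blast
    ultimately show ?thesis using S(2) by (simp add: gen_def)
  qed
  have "((\<lambda>s. \<Sum>y\<in>S. f y * law s y) has_real_derivative
      (\<Sum>y\<in>S. f y * ((\<Sum>e\<in>steps. law t (y - e) * q t (to_torus (y - e)) e) - law t y * (\<Sum>e\<in>steps. q t (to_torus y) e))))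
      (at t within {0..})"
    by (intro DERIV_sum DERIV_cmult master_equation t)
  also have "(\<Sum>y\<in>S. f y * ((\<Sum>e\<in>steps. law t (y - e) * q t (to_torus (y - e)) e) - law t y * (\<Sum>e\<in>steps. q t (to_torus y) e)))
      = (\<Sum>e\<in>steps. \<Sum>y\<in>S. f y * (law t (y - e) * q t (to_torus (y - e)) e)) -
        (\<Sum>y\<in>S. f y * (law t y * (\<Sum>e\<in>steps. q t (to_torus y) e)))"
    by (simp add: right_diff_distrib sum_subtractf sum_distrib_left[of "f _"] sum.swap[of _ steps])
  also have "\<dots> = (\<Sum>e\<in>steps. \<Sum>y\<in>S'. f (y + e) * q t (to_torus y) e * law t y) -
        (\<Sum>y\<in>S'. f y * (law t y * (\<Sum>e\<in>steps. q t (to_torus y) e)))"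
    by (simp add: into out)
  also have "\<dots> = (\<Sum>y\<in>S'. gen t f y * law t y)"
    by (simp add: sum.swap[of _ steps] gen_def left_diff_distrib right_diff_distrib sum_subtractf sum_distrib_left sum_distrib_right mult_ac)
  also have "\<dots> = expectation (\<lambda>w. gen t f (Y t w))"
    using gen0 by (rule expectation_finite_support[symmetric, OF t S'(1)])
  finally have "((\<lambda>s. \<Sum>y\<in>S. f y * law s y) has_real_derivative expectation (\<lambda>w. gen t f (Y t w))) (at t within {0..})" .
  then show ?thesis
    by (rule has_field_derivative_transform_within[of _ _ _ _ 1])
      (use t in \<open>auto simp: expectation_finite_support[of _ S f, OF _ S]\<close>)
qed

text \<open>A unit Lipschitz condition along steps. It survives minima and maxima, hence truncation,
  and bounds \<open>gen\<close> independently of the size of the support.\<close>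

definition short :: "(int ^ 'd \<Rightarrow> real) \<Rightarrow> bool" where
  "short f \<longleftrightarrow> (\<forall>y. \<forall>e\<in>steps. \<bar>f (y + e) - f y\<bar> \<le> 1)"

lemma gen_bound: "0 \<le> t \<Longrightarrow> short f \<Longrightarrow> \<bar>gen t f y\<bar> \<le> exit_rate"
  unfolding gen_def by (rule sum_rates_bound[where b = "\<lambda>_. to_torus y"]) (auto simp: short_def)

lemma integrable_bounded: "0 \<le> t \<Longrightarrow> (\<And>y. \<bar>g y\<bar> \<le> B) \<Longrightarrow> integrable M (\<lambda>w. g (Y t w))"
  for g :: "int ^ 'd \<Rightarrow> real"
  by (rule integrable_const_bound[of _ B]) (auto intro: borel_measurable_Y)

lemma expectation_bound:
  fixes g :: "int ^ 'd \<Rightarrow> real"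
  shows "0 \<le> t \<Longrightarrow> (\<And>y. \<bar>g y\<bar> \<le> B) \<Longrightarrow> \<bar>expectation (\<lambda>w. g (Y t w))\<bar> \<le> B"
  using integrable_bounded[of t g B]
  by (auto simp: abs_le_iff minus_le_iff intro!: integral_le_const integral_ge_const)

text \<open>The derivative exists at every time, and the gauge integral recovers a function from
  such a derivative.\<close>

lemma dynkin:
  assumes "0 \<le> t" "finite S" "\<And>y. y \<notin> S \<Longrightarrow> f y = 0"
  shows "((\<lambda>s. expectation (\<lambda>w. gen s f (Y s w))) has_integral
    expectation (\<lambda>w. f (Y t w)) - expectation (\<lambda>w. f (Y 0 w))) {0..t}"
  by (rule fundamental_theorem_of_calculus[OF assms(1)],
      simp only: has_real_derivative_iff_has_vector_derivative[symmetric],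
      rule DERIV_subset[OF expectation_deriv[OF _ assms(2,3)]]) auto

text \<open>A cone of slope 1 that vanishes outside the ball of radius \<open>n\<close>. A sharp
  cutoff would create jumps of order \<open>n\<close> at the boundary of the ball; the cone keeps
  truncated functions \<open>short\<close>.\<close>

definition cut :: "nat \<Rightarrow> int ^ 'd \<Rightarrow> real" where
  "cut n y = max 0 (real n - norm (real_vec y))"

lemma cut_outside: "y \<notin> {y. norm (real_vec y) \<le> real n} \<Longrightarrow> cut n y = 0"
  by (simp add: cut_def)

lemma norm_step: "e \<in> steps \<Longrightarrow> \<bar>norm (real_vec (y + e)) - norm (real_vec y)\<bar> \<le> 1"
  using norm_triangle_ineq3[of "real_vec (y + e)" "real_vec y"] by (simp add: real_vec_add norm_real_vec_step)

lemma component_step: "e \<in> steps \<Longrightarrow> \<bar>real_of_int ((y + e) $ j) - real_of_int (y $ j)\<bar> \<le> 1"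
  using component_le_norm_cart[of "real_vec e" j] by (simp add: norm_real_vec_step)

lemma cut_step: "e \<in> steps \<Longrightarrow> \<bar>cut n (y + e) - cut n y\<bar> \<le> 1"
  using norm_step[of e y] unfolding cut_def by linarith

lemma cut_large: "eventually (\<lambda>n. C \<le> cut n y) sequentially"
proof -
  obtain N :: nat where "norm (real_vec y) + C \<le> real N" using real_arch_simple by blast
  then have "C \<le> cut n y" if "N \<le> n" for n using that by (auto simp: cut_def)
  then show ?thesis by (auto simp: eventually_sequentially)
qed

text \<open>Dynkin's formula for the norm truncated by the cone bounds its mean by the initial first
  moment plus \<open>t * exit_rate\<close>, uniformly in \<open>n\<close>; monotone convergence then
  gives integrability.\<close>

lemma integrable_norm_Y:
  assumes t: "0 \<le> t"
  shows "integrable M (\<lambda>w. norm (real_vec (Y t w)))"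
proof -
  define f where "f n y = min (norm (real_vec y)) (cut n y)" for n and y :: "int ^ 'd"
  have f0: "y \<notin> {y. norm (real_vec y) \<le> real n} \<Longrightarrow> f n y = 0" for n y
    using cut_outside[of y n] by (simp add: f_def)
  have short: "short (f n)" for n
    using norm_step cut_step unfolding short_def f_def by (smt (verit, best))
  have f_abs: "\<bar>f n y\<bar> \<le> real n" for n y by (auto simp: f_def cut_def)
  have int0: "integrable M (\<lambda>w. norm (real_vec (Y 0 w)))"
    using lift by (auto simp: lifted_walk_def)
  define C where "C = expectation (\<lambda>w. norm (real_vec (Y 0 w))) + t * exit_rate"
  have le: "expectation (\<lambda>w. f n (Y t w)) \<le> C" for n
  proof -
    have gen_le: "expectation (\<lambda>w. gen s (f n) (Y s w)) \<le> exit_rate" if "0 \<le> s" for s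
      using expectation_bound[of s "gen s (f n)", OF that gen_bound[OF that short]] by (simp add: abs_le_iff)
    have "((\<lambda>s. exit_rate) has_integral t * exit_rate) {0..t}"
      using has_integral_const_real[of exit_rate 0 t] t by simp
    then have "expectation (\<lambda>w. f n (Y t w)) - expectation (\<lambda>w. f n (Y 0 w)) \<le> t * exit_rate"
      using gen_le by (intro has_integral_le[OF dynkin[OF t finite_lattice_ball f0]]) auto
    moreover have "expectation (\<lambda>w. f n (Y 0 w)) \<le> expectation (\<lambda>w. norm (real_vec (Y 0 w)))"
      by (rule integral_mono[OF integrable_bounded[OF order_refl f_abs] int0]) (simp add: f_def)
    ultimately show ?thesis by (simp add: C_def)
  qed
  have mono: "f m y \<le> f n y" if "m \<le> n" for m n y
    using that by (auto simp: f_def cut_def)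
  have "incseq (\<lambda>n. expectation (\<lambda>w. f n (Y t w)))"
    using t f_abs by (intro incseq_SucI integral_mono integrable_bounded) (auto intro: mono)
  then obtain L where L: "(\<lambda>n. expectation (\<lambda>w. f n (Y t w))) \<longlonglongrightarrow> L"
    using incseq_convergent le by blast
  show ?thesis
  proof (rule integrable_monotone_convergence[OF _ _ _ L])
    show "integrable M (\<lambda>w. f n (Y t w))" for n using t f_abs by (rule integrable_bounded)
    show "AE w in M. mono (\<lambda>n. f n (Y t w))" by (auto simp: mono_def mono)
    show "AE w in M. (\<lambda>n. f n (Y t w)) \<longlonglongrightarrow> norm (real_vec (Y t w))"
      by (intro AE_I2 tendsto_eventually) (auto simp: f_def min_def intro: eventually_mono[OF cut_large])
  qed (rule borel_measurable_Y[OF t])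
qed

text \<open>The coordinate is clipped between the cone and its negative. Clipping preserves unit
  increments, so the generators stay below \<open>exit_rate\<close>, while the clipped coordinates
  are dominated by the norm, which is integrable at every time; both sides of Dynkin's formula
  converge.\<close>

lemma drift_integral:
  assumes t: "0 \<le> t"
  shows "((\<lambda>s. expectation (\<lambda>w. \<Sum>e\<in>steps. real_of_int (e $ j) * q s (to_torus (Y s w)) e)) has_integral
    expectation (\<lambda>w. real_vec (Y t w) $ j) - expectation (\<lambda>w. real_vec (Y 0 w) $ j)) {0..t}"
proof -
  define f where "f n y = max (- cut n y) (min (cut n y) (real_vec y $ j))" for n and y :: "int ^ 'd"
  define G where "G s y = (\<Sum>e\<in>steps. real_of_int (e $ j) * q s (to_torus y) e)" for s and y :: "int ^ 'd"
  have f0: "y \<notin> {y. norm (real_vec y) \<le> real n} \<Longrightarrow> f n y = 0" for n y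
    using cut_outside[of y n] by (simp add: f_def)
  have short: "short (f n)" for n
    unfolding short_def
  proof (intro allI ballI)
    fix y e :: "int ^ 'd" assume e: "e \<in> steps"
    show "\<bar>f n (y + e) - f n y\<bar> \<le> 1"
      using cut_step[OF e, of n y] component_step[OF e, of y j] by (simp add: f_def)
  qed
  have cut_nonneg: "0 \<le> cut n y" for n y by (simp add: cut_def)
  have f_le: "\<bar>f n y\<bar> \<le> norm (real_vec y)" for n y
    using component_le_norm_cart[of "real_vec y" j] cut_nonneg[of n y] by (auto simp: f_def)
  have f_lim: "(\<lambda>n. f n y) \<longlonglongrightarrow> real_vec y $ j" for y
    by (rule tendsto_eventually, rule eventually_mono[OF cut_large[of "\<bar>real_vec y $ j\<bar>" y]]) (auto simp: f_def)
  have gen_lim: "(\<lambda>n. gen s (f n) y) \<longlonglongrightarrow> G s y" for s y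
  proof -
    have "(\<lambda>n. gen s (f n) y) \<longlonglongrightarrow> (\<Sum>e\<in>steps. (real_vec (y + e) $ j - real_vec y $ j) * q s (to_torus y) e)"
      unfolding gen_def by (intro tendsto_intros f_lim)
    then show ?thesis by (simp add: G_def)
  qed
  have E_lim: "(\<lambda>n. expectation (\<lambda>w. f n (Y s w))) \<longlonglongrightarrow> expectation (\<lambda>w. real_vec (Y s w) $ j)" if s: "0 \<le> s" for s
    by (rule integral_dominated_convergence[where w = "\<lambda>w. norm (real_vec (Y s w))"])
      (use s f_le f_lim in \<open>auto intro!: borel_measurable_Y integrable_norm_Y AE_I2 simp del: real_vec_component\<close>)
  have gen_E_lim: "(\<lambda>n. expectation (\<lambda>w. gen s (f n) (Y s w))) \<longlonglongrightarrow> expectation (\<lambda>w. G s (Y s w))" if s: "0 \<le> s" for s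
    by (rule integral_dominated_convergence[where w = "\<lambda>w. exit_rate"])
      (use s in \<open>auto intro: borel_measurable_Y gen_lim gen_bound[OF s short]\<close>)
  have D: "((\<lambda>s. expectation (\<lambda>w. gen s (f n) (Y s w))) has_integral
      expectation (\<lambda>w. f n (Y t w)) - expectation (\<lambda>w. f n (Y 0 w))) {0..t}" for n
    by (rule dynkin[OF t finite_lattice_ball f0])
  have gint: "(\<lambda>s. expectation (\<lambda>w. gen s (f n) (Y s w))) integrable_on {0..t}" for n
    using D by (rule has_integral_integrable)
  have cint: "(\<lambda>s. exit_rate) integrable_on {0..t}" by (rule integrable_const_ivl)
  have gle: "norm (expectation (\<lambda>w. gen s (f n) (Y s w))) \<le> exit_rate" if "s \<in> {0..t}" for s n
    unfolding real_norm_def using that by (intro expectation_bound gen_bound short) auto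
  have glim: "(\<lambda>n. expectation (\<lambda>w. gen s (f n) (Y s w))) \<longlonglongrightarrow> expectation (\<lambda>w. G s (Y s w))" if "s \<in> {0..t}" for s
    using that by (intro gen_E_lim) auto
  \<comment> \<open>A further dominated convergence, now in time, with the constant
    \<open>exit_rate\<close> as majorant.\<close>
  note conv = dominated_convergence[OF gint cint gle glim]
  have "(\<lambda>n. integral {0..t} (\<lambda>s. expectation (\<lambda>w. gen s (f n) (Y s w)))) \<longlonglongrightarrow>
      expectation (\<lambda>w. real_vec (Y t w) $ j) - expectation (\<lambda>w. real_vec (Y 0 w) $ j)"
    unfolding integral_unique[OF D] by (intro tendsto_diff E_lim t order_refl)
  from LIMSEQ_unique[OF conv(2) this]
  have "integral {0..t} (\<lambda>s. expectation (\<lambda>w. G s (Y s w))) =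
      expectation (\<lambda>w. real_vec (Y t w) $ j) - expectation (\<lambda>w. real_vec (Y 0 w) $ j)" .
  then show ?thesis using conv(1) by (simp add: has_integral_iff G_def)
qed

text \<open>Rates see the lattice position only through its torus site, so the drift can be averaged
  under the law of \<open>X\<close>.\<close>

lemma expectation_torus:
  assumes "0 \<le> t"
  shows "expectation (\<lambda>w. g (to_torus (Y t w))) = (\<Sum>a\<in>UNIV. g a * prob {w \<in> space M. X t w = a})"
proof -
  note [measurable] = measurable_Y[OF assms]
  have [measurable]: "{w \<in> space M. to_torus (Y t w) = a} \<in> sets M" for a :: "('n, 'd) torus"
  proof -
    have "{w \<in> space M. to_torus (Y t w) = a} = Y t -` {y. to_torus y = a} \<inter> space M" by auto
    then show ?thesis using measurable_sets[OF measurable_Y[OF assms], of "{y. to_torus y = a}"] by simp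
  qed
  have "expectation (\<lambda>w. g (to_torus (Y t w))) =
      expectation (\<lambda>w. \<Sum>a\<in>UNIV. g a * indicator {w \<in> space M. to_torus (Y t w) = a} w)"
  proof (rule Bochner_Integration.integral_cong[OF refl])
    fix w assume "w \<in> space M"
    then have "(\<Sum>a\<in>UNIV. g a * indicator {w \<in> space M. to_torus (Y t w) = a} w) = (\<Sum>a\<in>UNIV. if a = to_torus (Y t w) then g a else 0)"
      by (intro sum.cong) auto
    then show "g (to_torus (Y t w)) = (\<Sum>a\<in>UNIV. g a * indicator {w \<in> space M. to_torus (Y t w) = a} w)"
      by (simp add: sum.delta)
  qed
  also have "\<dots> = (\<Sum>a\<in>UNIV. expectation (\<lambda>w. g a * indicator {w \<in> space M. to_torus (Y t w) = a} w))"
    by (rule Bochner_Integration.integral_sum) (auto intro!: integrable_mult_right integrable_real_indicator simp: less_top[symmetric])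
  also have "\<dots> = (\<Sum>a\<in>UNIV. g a * prob {w \<in> space M. to_torus (Y t w) = a})"
    by simp
  also have "\<dots> = (\<Sum>a\<in>UNIV. g a * prob {w \<in> space M. X t w = a})"
    using to_torus_Y[OF assms] by (intro sum.cong arg_cong2[where f = "(*)"] arg_cong[where f = prob]) auto
  finally show ?thesis .
qed

text \<open>Continuity in time of the rates and laws makes the averaged drift a continuous
  integrand, so the integral formula can be differentiated at every \<open>t\<close>, from the right
  at 0.\<close>

theorem mean_velocity_eq:
  assumes cont: "\<And>e a. e \<in> steps \<Longrightarrow> continuous_on {0..} (\<lambda>s. q s a e)"
    "\<And>a. continuous_on {0..} (\<lambda>s. prob {w \<in> space M. X s w = a})"
    and t: "0 \<le> t"
  shows "mean_velocity M Y t =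
    (\<chi> j. \<Sum>a\<in>UNIV. (\<Sum>e\<in>steps. real_of_int (e $ j) * q t a e) * prob {w \<in> space M. X t w = a})"
proof -
  define G where "G j s = (\<Sum>a\<in>UNIV. (\<Sum>e\<in>steps. real_of_int (e $ j) * q s a e) * prob {w \<in> space M. X s w = a})" for j s
  have G_cont: "continuous_on {0..b} (G j)" for j b
    unfolding G_def by (rule continuous_on_subset[of "{0..}"]) (auto intro!: continuous_intros cont)
  define F where "F s = expectation (\<lambda>w. real_vec (Y s w))" for s
  have F_comp: "F s $ j = expectation (\<lambda>w. real_vec (Y s w) $ j)" if s: "0 \<le> s" for s j
  proof -
    have "integrable M (\<lambda>w. real_vec (Y s w))"
      using integrable_norm_Y[OF s] by (subst (asm) integrable_norm_iff) (auto intro: borel_measurable_Y s)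
    then show ?thesis unfolding F_def
      by (rule integral_bounded_linear[OF bounded_linear_vec_nth, symmetric])
  qed
  have int: "(G j has_integral F s $ j - F 0 $ j) {0..s}" if s: "0 \<le> s" for s j
  proof (rule has_integral_eq[OF _ drift_integral[OF s, of j, folded F_comp[OF s] F_comp[OF order_refl]]])
    fix u assume "u \<in> {0..s}"
    then show "expectation (\<lambda>w. \<Sum>e\<in>steps. real_of_int (e $ j) * q u (to_torus (Y u w)) e) = G j u"
      unfolding G_def by (subst expectation_torus[symmetric]) auto
  qed
  \<comment> \<open>The integral is differentiated on a compact interval, which agrees with the
    half-line near \<open>t\<close>, also for \<open>t = 0\<close>.\<close>
  have nhd: "at t within {0..t + 1} = at t within {0..}"
    by (rule at_within_nhd[of _ "{t - 1<..<t + 1}"]) auto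
  have "((\<lambda>s. F s $ j) has_real_derivative G j t) (at t within {0..})" for j
  proof -
    have "((\<lambda>s. F 0 $ j + integral {0..s} (G j)) has_real_derivative G j t) (at t within {0..t + 1})"
      using integral_has_real_derivative[OF G_cont[of "t + 1" j], of t] t by (auto intro!: derivative_eq_intros)
    then have "((\<lambda>s. F s $ j) has_real_derivative G j t) (at t within {0..t + 1})"
      by (rule has_field_derivative_transform_within[of _ _ _ _ 1]) (use t in \<open>auto simp: integral_unique[OF int]\<close>)
    then show ?thesis unfolding nhd .
  qed
  then have "(F has_vector_derivative (\<chi> j. G j t)) (at t within {0..})"
    by (intro has_vector_derivative_vec) simp
  moreover have "at t within {0..} \<noteq> bot"
    using t unfolding nhd[symmetric] by (auto simp: trivial_limit_within)
  ultimately show ?thesis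
    unfolding mean_velocity_def F_def[symmetric] by (simp add: vector_derivative_within G_def)
qed

end

section \<open>Linear response of the oscillatory steady state\<close>

text \<open>For x < 0 the upper bound combines (1 + x + x^2)(1 - x) = 1 - x^3 \<ge> 1 with exp (- x)
  \<ge> 1 - x.\<close>

lemma abs_exp_minus_linear: "\<bar>exp x - 1 - x\<bar> \<le> x\<^sup>2" if "\<bar>x\<bar> \<le> 1" for x :: real
proof (cases "0 \<le> x")
  case True
  then show ?thesis using exp_bound[of x] exp_ge_add_one_self[of x] that by linarith
next
  case False
  have "1 \<le> (1 + x + x\<^sup>2) * (1 - x)"
    using False by (simp add: algebra_simps power2_eq_square mult_nonneg_nonpos2)
  also have "\<dots> \<le> (1 + x + x\<^sup>2) * exp (- x)"
    using exp_ge_add_one_self[of "- x"] that by (intro mult_left_mono) auto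
  finally have "exp x \<le> 1 + x + x\<^sup>2" by (simp add: exp_minus field_simps)
  then show ?thesis using exp_ge_add_one_self[of x] by linarith
qed

lemma abs_exp_minus_one: "\<bar>exp x - 1\<bar> \<le> 2 * \<bar>x\<bar>" if "\<bar>x\<bar> \<le> 1" for x :: real
proof -
  have "x\<^sup>2 \<le> \<bar>x\<bar>" using mult_left_le[OF that abs_ge_zero[of x]] by (simp add: power2_eq_square)
  then show ?thesis using abs_exp_minus_linear[OF that] by linarith
qed

text \<open>At \<open>x = 0\<close> the bound forces \<open>a = f 0\<close>, so it controls the
  difference quotient. The derivative is one-sided because \<open>lam\<close> ranges over
  nonnegative values.\<close>

lemma DERIV_of_quadratic_bound:
  fixes f :: "real \<Rightarrow> real"
  assumes "\<And>x. 0 \<le> x \<Longrightarrow> x \<le> 1 \<Longrightarrow> \<bar>f x - a - x * D\<bar> \<le> C * x\<^sup>2"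
  shows "(f has_real_derivative D) (at 0 within {0..})"
proof -
  have "f 0 = a" using assms[of 0] by simp
  have "((\<lambda>x. (f x - f 0) / (x - 0)) \<longlongrightarrow> D) (at 0 within {0..})"
  proof (rule Lim_null_comparison[of _ "\<lambda>x. C * x", THEN LIM_zero_cancel])
    show "\<forall>\<^sub>F x in at 0 within {0..}. norm ((f x - f 0) / (x - 0) - D) \<le> C * x"
      unfolding eventually_at
    proof (intro exI[of _ 1] conjI ballI impI)
      fix x :: real assume x: "x \<in> {0..}" "x \<noteq> 0 \<and> dist x 0 < 1"
      then have "norm ((f x - f 0) / (x - 0) - D) = \<bar>f x - a - x * D\<bar> / x"
        using \<open>f 0 = a\<close> by (simp add: field_simps abs_divide)
      also have "\<dots> \<le> C * x\<^sup>2 / x" using x by (intro divide_right_mono assms) (auto simp: dist_real_def)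
      finally show "norm ((f x - f 0) / (x - 0) - D) \<le> C * x" using x by (simp add: power2_eq_square)
    qed simp
    show "((\<lambda>x. C * x) \<longlongrightarrow> 0) (at 0 within {0..})" by (auto intro!: tendsto_eq_intros)
  qed
  then show ?thesis by (simp add: has_field_derivative_iff)
qed

section \<open>Source terms in the equation for the density\<close>

context stationary_walk
begin

text \<open>The forward operator with jump intensities \<open>a\<close>, relative to
  \<open>\<pi>\<close>. It is linear in both arguments, and is applied also to differences of laws
  and to Taylor remainders of the rates.\<close>

definition forcing :: "(('n, 'd) torus \<Rightarrow> real) \<Rightarrow> ('n, 'd) rates \<Rightarrow> ('n, 'd) torus \<Rightarrow> real" where
  "forcing \<mu> a y = ((\<Sum>e\<in>steps. \<mu> (y - to_torus e) * a (y - to_torus e) e) - \<mu> y * (\<Sum>e\<in>steps. a y e)) / \<pi> y"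

lemma forcing_add: "forcing \<mu> (\<lambda>x e. a x e + b x e) y = forcing \<mu> a y + forcing \<mu> b y"
  by (simp add: forcing_def sum.distrib distrib_left add_divide_distrib diff_divide_distrib)

lemma forcing_cmult: "forcing \<mu> (\<lambda>x e. c * a x e) y = c * forcing \<mu> a y"
  by (simp add: forcing_def sum_distrib_left right_diff_distrib mult_ac)

lemma forcing_diff: "forcing (\<lambda>x. \<mu> x - \<nu> x) a y = forcing \<mu> a y - forcing \<nu> a y"
  by (simp add: forcing_def sum_subtractf left_diff_distrib diff_divide_distrib)

text \<open>Only the products \<open>\<mu> x * a x e\<close> are controlled, so smallness may come
  from either factor or from both; the second-order estimate rests on this.\<close>

lemma forcing_bound:
  "\<exists>K>0. \<forall>\<mu> a B y. (\<forall>x. \<forall>e\<in>steps. \<bar>\<mu> x * a x e\<bar> \<le> B) \<longrightarrow> \<bar>forcing \<mu> a y\<bar> \<le> K * B"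
proof -
  define m where "m = Min (range \<pi>)"
  define c where "c = real (card (steps :: (int ^ 'd) set))"
  have m: "0 < m" "m \<le> \<pi> x" for x
    unfolding m_def by (auto intro: pi_pos)
  have c: "0 < c" by (simp add: c_def card_gt_0_iff)
  have bound: "\<bar>forcing \<mu> a y\<bar> \<le> 2 * c / m * B"
    if B: "\<And>x e. e \<in> steps \<Longrightarrow> \<bar>\<mu> x * a x e\<bar> \<le> B" for \<mu> :: "('n, 'd) torus \<Rightarrow> real" and a :: "('n, 'd) rates" and B y
  proof -
  have "0 \<le> B" using B[of "axis undefined 1" undefined] by (intro order_trans[OF abs_ge_zero]) auto
  have "\<bar>\<Sum>e\<in>steps. \<mu> (y - to_torus e) * a (y - to_torus e) e\<bar> \<le> (\<Sum>e\<in>(steps :: (int ^ 'd) set). B)"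
    by (rule order_trans[OF sum_abs sum_mono]) (rule B)
  moreover have "\<bar>\<Sum>e\<in>steps. \<mu> y * a y e\<bar> \<le> (\<Sum>e\<in>(steps :: (int ^ 'd) set). B)"
    by (rule order_trans[OF sum_abs sum_mono]) (rule B)
  ultimately have "\<bar>(\<Sum>e\<in>steps. \<mu> (y - to_torus e) * a (y - to_torus e) e) - \<mu> y * (\<Sum>e\<in>steps. a y e)\<bar> \<le> 2 * c * B"
    by (simp add: c_def sum_distrib_left)
  then have "\<bar>forcing \<mu> a y\<bar> \<le> 2 * c * B / \<pi> y"
    using pi_pos[of y] by (simp add: forcing_def abs_divide divide_right_mono)
  also have "\<dots> \<le> 2 * c * B / m" using m c \<open>0 \<le> B\<close> by (intro divide_left_mono) (auto intro: mult_pos_pos pi_pos)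
  finally show ?thesis by simp
  qed
  moreover have "0 < 2 * c / m" using m c by simp
  ultimately show ?thesis by (intro exI[of _ "2 * c / m"] conjI allI impI bound) auto
qed

text \<open>Time reversal as a change of variables: reversing each direction turns the inflow under
  \<open>r\<close> into the gain term of the reversed walk acting on the density. The weight is then
  evaluated at \<open>- e\<close>.\<close>

lemma sum_rates_into:
  "(\<Sum>e\<in>steps. \<mu> (y - to_torus e) * r (y - to_torus e) e * c e) / \<pi> y =
    (\<Sum>e\<in>steps. rs y e * (\<mu> (y + to_torus e) / \<pi> (y + to_torus e)) * c (- e))"
proof -
  have "(\<Sum>e\<in>steps. \<mu> (y - to_torus e) * r (y - to_torus e) e * c e) / \<pi> y =
      (\<Sum>e\<in>steps. \<mu> (y + to_torus e) * r (y + to_torus e) (- e) * c (- e) / \<pi> y)"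
    unfolding sum_divide_distrib by (subst sum_steps_uminus[symmetric]) simp
  also have "\<dots> = (\<Sum>e\<in>steps. rs y e * (\<mu> (y + to_torus e) / \<pi> (y + to_torus e)) * c (- e))"
    using pi_pos by (intro sum.cong refl) (simp add: rev_rates_def less_imp_neq[THEN not_sym])
  finally show ?thesis .
qed

lemma forcing_rates: "forcing \<mu> r y = Lstar (\<lambda>x. \<mu> x / \<pi> x) y"
proof -
  have "forcing \<mu> r y = (\<Sum>e\<in>steps. rs y e * (\<mu> (y + to_torus e) / \<pi> (y + to_torus e))) -
      \<mu> y / \<pi> y * (\<Sum>e\<in>steps. r y e)"
    using sum_rates_into[of \<mu> y "\<lambda>_. 1"] by (simp add: forcing_def diff_divide_distrib)
  then show ?thesis
    unfolding sum_rs[symmetric] by (simp add: Lstar_def right_diff_distrib sum_subtractf sum_distrib_left mult_ac)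
qed

text \<open>The inflow weight changes sign under reversal, so inflow and outflow contributions add
  up instead of cancelling; hence the sum of both rates and the minus sign in
  \<open>Psi_fun\<close>.\<close>

lemma forcing_pi: "forcing \<pi> (\<lambda>x e. (real_vec e \<bullet> v) * r x e) y = Psi_fun r \<pi> y \<bullet> v"
proof -
  have "forcing \<pi> (\<lambda>x e. (real_vec e \<bullet> v) * r x e) y =
      (\<Sum>e\<in>steps. rs y e * - (real_vec e \<bullet> v)) - (\<Sum>e\<in>steps. r y e * (real_vec e \<bullet> v))"
    using sum_rates_into[of \<pi> y "\<lambda>e. real_vec e \<bullet> v"] pi_pos
    by (simp add: forcing_def diff_divide_distrib mult_ac less_imp_neq[THEN not_sym])
  also have "\<dots> = Psi_fun r \<pi> y \<bullet> v"
    by (simp add: Psi_fun_def inner_sum_left inner_add_left sum.distrib sum_negf scaleR_add_left algebra_simps)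
  finally show ?thesis .
qed

lemma Lstar_const [simp]: "Lstar (\<lambda>x. c) y = 0"
  by (simp add: Lstar_def)

lemma Lstar_diff: "Lstar (\<lambda>x. f x - g x) y = Lstar f y - Lstar g y"
  by (simp add: Lstar_def sum_subtractf scaleR_diff_right)

lemma Lstar_cmult: "Lstar (\<lambda>x. c * f x) y = c * Lstar f y" for f :: "_ \<Rightarrow> 'b::real_algebra"
  by (simp add: Lstar_def sum_distrib_left right_diff_distrib)

text \<open>The mean drift of the reversed walk is minus that of the walk. The components of
  \<open>Psi_fun\<close> therefore lie in the zero-mean space, where the semigroup decays.\<close>

lemma sum_pi_Psi: "(\<Sum>x\<in>UNIV. \<pi> x *\<^sub>R Psi_fun r \<pi> x) = 0"
proof -
  have "(\<Sum>x\<in>UNIV. \<pi> x *\<^sub>R (\<Sum>e\<in>steps. rs x e *\<^sub>R real_vec e)) =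
      (\<Sum>e\<in>steps. \<Sum>x\<in>UNIV. (\<pi> (x + to_torus e) * r (x + to_torus e) (- e)) *\<^sub>R real_vec e)"
    by (simp add: scaleR_sum_right pi_rs sum.swap[of _ steps])
  also have "\<dots> = (\<Sum>e\<in>steps. \<Sum>x\<in>UNIV. (\<pi> x * r x (- e)) *\<^sub>R real_vec e)"
    by (intro sum.cong refl sum_torus_shift[where g = "\<lambda>x. (\<pi> x * r x (- _)) *\<^sub>R real_vec _"])
  also have "\<dots> = - (\<Sum>e\<in>steps. \<Sum>x\<in>UNIV. (\<pi> x * r x e) *\<^sub>R real_vec e)"
    by (subst sum_steps_uminus[symmetric]) (simp add: sum_negf)
  also have "\<dots> = - (\<Sum>x\<in>UNIV. \<pi> x *\<^sub>R (\<Sum>e\<in>steps. r x e *\<^sub>R real_vec e))"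
    by (simp add: scaleR_sum_right sum.swap[of _ steps])
  finally show ?thesis
    by (simp add: Psi_fun_def sum.distrib scaleR_add_left scaleR_add_right scaleR_diff_right sum_subtractf sum_negf)
qed

lemma sum_pi_cplx_Psi: "(\<Sum>x\<in>UNIV. of_real (\<pi> x) * cplx_comp (Psi_fun r \<pi>) k x) = 0"
proof -
  have "(\<Sum>x\<in>UNIV. of_real (\<pi> x) * cplx_comp (Psi_fun r \<pi>) k x) =
      of_real ((\<Sum>x\<in>UNIV. \<pi> x *\<^sub>R Psi_fun r \<pi> x) $ k)"
    by (simp add: cplx_comp_def)
  then show ?thesis by (simp add: sum_pi_Psi)
qed

lemma resolved_sum: "resolved \<omega> (\<lambda>x. \<Sum>k\<in>I. f k x) = (\<lambda>x. \<Sum>k\<in>I. resolved \<omega> (f k) x)"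
  by (simp add: fun_eq_iff op.A sum_distrib_left sum.swap[of _ I])

lemma resolved_cmult: "resolved \<omega> (\<lambda>x. c * f x) = (\<lambda>x. c * resolved \<omega> f x)"
  by (simp add: fun_eq_iff resolved_eq Lstar_cmult algebra_simps)

lemma resolvent_cmult: "\<omega> \<noteq> 0 \<Longrightarrow> resolvent \<omega> (\<lambda>x. c * f x) = (\<lambda>x. c * resolvent \<omega> f x)"
  by (rule resolventI) (simp_all add: resolved_cmult resolved_resolvent)

section \<open>The periodic solution of the linearized equation\<close>

definition amplitude :: "real \<Rightarrow> real ^ 'd \<Rightarrow> ('n, 'd) torus \<Rightarrow> complex" where
  "amplitude \<omega> v = resolvent \<omega> (\<lambda>y. of_real (Psi_fun r \<pi> y \<bullet> v))"

lemma amplitude_eq: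
  assumes "\<omega> \<noteq> 0"
  shows "amplitude \<omega> v x = (\<Sum>k\<in>UNIV. of_real (v $ k) * resolvent \<omega> (cplx_comp (Psi_fun r \<pi>) k) x)"
proof -
  have "amplitude \<omega> v = (\<lambda>x. \<Sum>k\<in>UNIV. of_real (v $ k) * resolvent \<omega> (cplx_comp (Psi_fun r \<pi>) k) x)"
    unfolding amplitude_def using assms
    by (intro resolventI)
      (simp_all add: resolved_sum resolved_cmult resolved_resolvent cplx_comp_def inner_vec_def fun_eq_iff mult.commute)
  then show ?thesis by simp
qed

text \<open>First-order term of the density relative to \<open>\<pi>\<close>; the law itself
  responds by \<open>\<pi>\<close> times this function.\<close>

definition response :: "real \<Rightarrow> real ^ 'd \<Rightarrow> real \<Rightarrow> ('n, 'd) torus \<Rightarrow> real" where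
  "response \<omega> v t x = Re (exp (\<i> * of_real (\<omega> * t)) * amplitude \<omega> v x)"

text \<open>The resolvent equation of the amplitude is multiplied by exp (i \<omega> t) and its real
  part taken; \<open>Lstar\<close> has real coefficients, so it commutes with the real part.\<close>

lemma response_deriv:
  assumes "\<omega> \<noteq> 0"
  shows "((\<lambda>t. response \<omega> v t x) has_real_derivative
    Lstar (response \<omega> v t) x + cos (\<omega> * t) * (Psi_fun r \<pi> x \<bullet> v)) (at t within S)"
proof -
  have amp: "\<i> * of_real \<omega> * amplitude \<omega> v x = Lstar (amplitude \<omega> v) x + of_real (Psi_fun r \<pi> x \<bullet> v)"
    using fun_cong[OF resolved_resolvent[OF assms, of "\<lambda>y. of_real (Psi_fun r \<pi> y \<bullet> v)"], of x]
    unfolding amplitude_def[symmetric] resolved_eq by (simp add: algebra_simps)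
  have E: "((\<lambda>t. exp (\<i> * of_real (\<omega> * t))) has_vector_derivative \<i> * of_real \<omega> * exp (\<i> * of_real (\<omega> * t))) (at t within S)"
  proof -
    have "((\<lambda>z. exp (\<i> * of_real \<omega> * z)) has_field_derivative \<i> * of_real \<omega> * exp (\<i> * of_real \<omega> * of_real t)) (at (of_real t))"
      by (auto intro!: derivative_eq_intros)
    from has_vector_derivative_real_field[OF this] show ?thesis by (simp add: mult.assoc)
  qed
  have "((\<lambda>t. Re (exp (\<i> * of_real (\<omega> * t)) * amplitude \<omega> v x)) has_vector_derivative
      Re (\<i> * of_real \<omega> * exp (\<i> * of_real (\<omega> * t)) * amplitude \<omega> v x)) (at t within S)"
    by (intro bounded_linear.has_vector_derivative[OF bounded_linear_Re] has_vector_derivative_mult_left E)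
  moreover have "Re (\<i> * of_real \<omega> * exp (\<i> * of_real (\<omega> * t)) * amplitude \<omega> v x) =
      Lstar (response \<omega> v t) x + cos (\<omega> * t) * (Psi_fun r \<pi> x \<bullet> v)"
  proof -
    have "\<i> * of_real \<omega> * exp (\<i> * of_real (\<omega> * t)) * amplitude \<omega> v x =
        Lstar (\<lambda>x. exp (\<i> * of_real (\<omega> * t)) * amplitude \<omega> v x) x +
        exp (\<i> * of_real (\<omega> * t)) * of_real (Psi_fun r \<pi> x \<bullet> v)"
      unfolding Lstar_cmult distrib_left[symmetric] amp[symmetric] by (simp only: mult_ac)
    then show ?thesis by (simp only: plus_complex.sel Re_Lstar) (simp add: response_def[abs_def] Re_exp)
  qed
  ultimately show ?thesis by (simp add: response_def has_real_derivative_iff_has_vector_derivative)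
qed

lemma response_periodic:
  assumes "\<omega> \<noteq> 0"
  shows "response \<omega> v (2 * pi / \<bar>\<omega>\<bar>) = response \<omega> v 0"
proof -
  \<comment> \<open>The exponent is 2 pi i times the sign of \<omega>, hence the two
    witnesses.\<close>
  have "exp (\<i> * of_real (\<omega> * (2 * pi / \<bar>\<omega>\<bar>))) = 1"
    using assms by (cases "0 < \<omega>") (auto simp: exp_eq_1 Re_exp intro: exI[of _ 1] exI[of _ "-1"])
  then show ?thesis by (simp add: response_def fun_eq_iff)
qed

lemma sum_pi_response:
  assumes "\<omega> \<noteq> 0"
  shows "(\<Sum>x\<in>UNIV. \<pi> x * response \<omega> v t x) = 0"
proof -
  have "(\<Sum>x\<in>UNIV. \<pi> x * (Psi_fun r \<pi> x \<bullet> v)) = (\<Sum>x\<in>UNIV. \<pi> x *\<^sub>R Psi_fun r \<pi> x) \<bullet> v"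
    by (simp add: inner_sum_left)
  then have "(\<Sum>x\<in>UNIV. of_real (\<pi> x) * complex_of_real (Psi_fun r \<pi> x \<bullet> v)) = 0"
    unfolding of_real_mult[symmetric] of_real_sum[symmetric] by (simp add: sum_pi_Psi)
  from sum_pi_resolvent[OF assms this]
  have "(\<Sum>x\<in>UNIV. of_real (\<pi> x) * (exp (\<i> * of_real (\<omega> * t)) * amplitude \<omega> v x)) = 0"
    unfolding amplitude_def[symmetric] mult.left_commute[of "of_real (\<pi> _)"] sum_distrib_left[symmetric] by simp
  from sum_pi_Re_Im(1)[OF this] show ?thesis by (simp add: response_def)
qed

lemma rates_bounded: "\<exists>R>0. \<forall>x. \<forall>e\<in>steps. r x e \<le> R"
proof (intro exI conjI allI ballI)
  show "0 < (\<Sum>x\<in>UNIV. \<Sum>e\<in>steps. r x e)"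
  proof (rule sum_pos)
    show "0 < (\<Sum>e\<in>steps. r x e)" for x by (rule sum_pos) (auto intro: rates_pos)
  qed auto
  fix x and e :: "int ^ 'd" assume e: "e \<in> steps"
  have "r x e \<le> (\<Sum>e\<in>steps. r x e)"
    using e by (intro member_le_sum) (auto intro: less_imp_le rates_pos)
  also have "\<dots> \<le> (\<Sum>x\<in>UNIV. \<Sum>e\<in>steps. r x e)"
    by (intro member_le_sum) (auto intro!: sum_nonneg intro: less_imp_le rates_pos)
  finally show "r x e \<le> (\<Sum>x\<in>UNIV. \<Sum>e\<in>steps. r x e)" .
qed

text \<open>Bounding \<open>\<mu> lam - \<pi>\<close> by a multiple of \<open>lam\<close> first makes the second-order remainder of the
  equation for \<open>\<mu> lam - \<pi> - lam \<pi> W\<close> a multiple of \<open>lam\<^sup>2\<close>.\<close>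

lemma steady_state_expansion:
  assumes v: "norm v = 1" and \<omega>: "\<omega> \<noteq> 0"
    and master: "\<And>lam t y. 0 \<le> lam \<Longrightarrow> 0 \<le> t \<Longrightarrow> ((\<lambda>s. \<mu> lam s y) has_real_derivative
      (\<Sum>e\<in>steps. \<mu> lam t (y - to_torus e) * perturbed_rates r v \<omega> lam t (y - to_torus e) e) -
      \<mu> lam t y * (\<Sum>e\<in>steps. perturbed_rates r v \<omega> lam t y e)) (at t within {0..})"
    and nonneg: "\<And>lam t y. 0 \<le> lam \<Longrightarrow> 0 \<le> t \<Longrightarrow> 0 \<le> \<mu> lam t y"
    and total: "\<And>lam t. 0 \<le> lam \<Longrightarrow> 0 \<le> t \<Longrightarrow> (\<Sum>y\<in>UNIV. \<mu> lam t y) = 1"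
    and periodic: "\<And>lam. 0 \<le> lam \<Longrightarrow> \<mu> lam (2 * pi / \<bar>\<omega>\<bar>) = \<mu> lam 0"
  shows "\<exists>C. \<forall>lam t y. 0 \<le> lam \<and> lam \<le> 1 \<and> 0 \<le> t \<longrightarrow>
    \<bar>\<mu> lam t y - \<pi> y - lam * (\<pi> y * response \<omega> v t y)\<bar> \<le> C * lam\<^sup>2"
proof -
  define T where "T = 2 * pi / \<bar>\<omega>\<bar>"
  have T: "0 < T" using \<omega> by (simp add: T_def)
  obtain K where K: "0 < K" and stable: "\<forall>w F T \<epsilon>.
    (\<forall>t\<ge>0. \<forall>y. ((\<lambda>s. w s y) has_real_derivative Lstar (w t) y + F t y) (at t within {0..})) \<longrightarrow>
    (\<forall>t\<ge>0. \<forall>y. \<bar>F t y\<bar> \<le> \<epsilon>) \<longrightarrow> (\<forall>t\<ge>0. (\<Sum>x\<in>UNIV. \<pi> x * w t x) = 0) \<longrightarrow>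
    0 < T \<longrightarrow> w T = w 0 \<longrightarrow> (\<forall>t\<ge>0. \<forall>y. \<bar>w t y\<bar> \<le> K * \<epsilon>)"
    using periodic_response_bound by auto
  obtain L where L: "0 < L" and forcing: "\<And>\<mu> a B y. (\<And>x e. e \<in> steps \<Longrightarrow> \<bar>\<mu> x * a x e\<bar> \<le> B) \<Longrightarrow> \<bar>forcing \<mu> a y\<bar> \<le> L * B"
    using forcing_bound by auto
  obtain R where R: "0 < R" "\<And>x e. e \<in> steps \<Longrightarrow> r x e \<le> R" using rates_bounded by auto
  define W where "W = response \<omega> v"
  define b where "b x e = (real_vec e \<bullet> v) * r x e" for x e
  \<comment> \<open>\<open>A * lam\<close> bounds \<open>z\<close>: the first source is at most
    \<open>L * (2 * lam * R)\<close>, the factor 2 coming from |exp s - 1| \<le> 2 |s|.\<close>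
  define A where "A = K * (L * (2 * R))"
  \<comment> \<open>Two second-order sources: the deviation of the law (\<open>A\<close>) times that
    of the rates (\<open>2 * R\<close>), and the Taylor remainder of the rates
    (\<open>R\<close>).\<close>
  define B where "B = A * (2 * R) + R"
  have A: "0 < A" using K L R by (simp add: A_def)
  have "\<bar>\<mu> lam t y - \<pi> y - lam * (\<pi> y * W t y)\<bar> \<le> K * (L * B) * lam\<^sup>2"
    if lam: "0 \<le> lam" "lam \<le> 1" and t: "0 \<le> t" for lam t y
  proof -
    define a where "a t x e = perturbed_rates r v \<omega> lam t x e - r x e" for t x e
    define u where "u t x = \<mu> lam t x / \<pi> x" for t x
    define z where "z t x = u t x - 1" for t x
    have \<mu>_eq: "\<mu> lam t x = \<pi> x * u t x" for t x using pi_pos[of x] by (simp add: u_def)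
    have \<mu>_le: "\<mu> lam t x \<le> 1" if "0 \<le> t" for t x
      using total[OF lam(1) that] member_le_sum[of x UNIV "\<mu> lam t"] nonneg[OF lam(1) that] by auto
    have arg: "\<bar>lam * cos (\<omega> * t) * (real_vec e \<bullet> v)\<bar> \<le> lam" if "e \<in> steps" for t e
    proof -
      have "\<bar>real_vec e \<bullet> v\<bar> \<le> 1"
        using Cauchy_Schwarz_ineq2[of "real_vec e" v] norm_real_vec_step[OF that] v by simp
      then have "\<bar>cos (\<omega> * t)\<bar> * \<bar>real_vec e \<bullet> v\<bar> \<le> 1 * 1" by (intro mult_mono) auto
      then show ?thesis using lam by (simp add: abs_mult mult.assoc mult_left_le)
    qed
    have r_abs: "\<bar>r x e\<bar> \<le> R" if "e \<in> steps" for x e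
      using R(2)[OF that, of x] rates_pos[OF that, of x] by simp
    have a_le: "\<bar>a t x e\<bar> \<le> 2 * lam * R" if e: "e \<in> steps" for t x e
    proof -
      have "\<bar>exp (lam * cos (\<omega> * t) * (real_vec e \<bullet> v)) - 1\<bar> \<le> 2 * lam"
        using abs_exp_minus_one[of "lam * cos (\<omega> * t) * (real_vec e \<bullet> v)"] arg[OF e, of t] lam by linarith
      then have "\<bar>exp (lam * cos (\<omega> * t) * (real_vec e \<bullet> v)) - 1\<bar> * \<bar>r x e\<bar> \<le> 2 * lam * R"
        using r_abs[OF e] lam by (intro mult_mono) auto
      then show ?thesis by (simp add: a_def perturbed_rates_def left_diff_distrib flip: abs_mult)
    qed
    have a2_le: "\<bar>a t x e + - (lam * cos (\<omega> * t)) * b x e\<bar> \<le> lam\<^sup>2 * R" if e: "e \<in> steps" for t x e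
    proof -
      let ?s = "lam * cos (\<omega> * t) * (real_vec e \<bullet> v)"
      have "?s\<^sup>2 \<le> lam\<^sup>2" using arg[OF e, of t] lam by (simp add: abs_le_square_iff[symmetric])
      then have "\<bar>exp ?s - 1 - ?s\<bar> \<le> lam\<^sup>2"
        using abs_exp_minus_linear[of ?s] arg[OF e, of t] lam by linarith
      then have "\<bar>exp ?s - 1 - ?s\<bar> * \<bar>r x e\<bar> \<le> lam\<^sup>2 * R"
        using r_abs[OF e] by (intro mult_mono) auto
      then show ?thesis
        by (simp add: a_def b_def perturbed_rates_def left_diff_distrib mult.assoc flip: abs_mult)
    qed
    have du: "((\<lambda>s. u s x) has_real_derivative Lstar (u t) x + forcing (\<mu> lam t) (a t) x) (at t within {0..})"
      if t: "0 \<le> t" for t x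
    proof -
      have "((\<lambda>s. u s x) has_real_derivative forcing (\<mu> lam t) (perturbed_rates r v \<omega> lam t) x) (at t within {0..})"
        unfolding u_def forcing_def by (rule DERIV_cdivide[OF master[OF lam(1) t]])
      moreover have "forcing (\<mu> lam t) (perturbed_rates r v \<omega> lam t) x = forcing (\<mu> lam t) r x + forcing (\<mu> lam t) (a t) x"
        using forcing_add[of "\<mu> lam t" r "a t" x] by (simp add: a_def)
      ultimately show ?thesis by (simp add: forcing_rates u_def[abs_def])
    qed
    have Lz: "Lstar (z t) x = Lstar (u t) x" for t x
      unfolding z_def by (simp add: Lstar_diff)
    have mean_z: "(\<Sum>x\<in>UNIV. \<pi> x * z t x) = 0" if "0 \<le> t" for t
      using total[OF lam(1) that] by (simp add: z_def \<mu>_eq right_diff_distrib sum_subtractf pi_sum)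
    have z_bound: "\<bar>z t x\<bar> \<le> A * lam" if t: "0 \<le> t" for t x
    proof -
      have "((\<lambda>s. z s x) has_real_derivative Lstar (z t) x + forcing (\<mu> lam t) (a t) x) (at t within {0..})"
        if "0 \<le> t" for t x
        unfolding Lz unfolding z_def by (rule DERIV_cong[OF DERIV_diff[OF du[OF that] DERIV_const]]) simp
      moreover have "\<bar>forcing (\<mu> lam t) (a t) x\<bar> \<le> L * (2 * lam * R)" if t: "0 \<le> t" for t x
      proof (rule forcing)
        fix x and e :: "int ^ 'd" assume e: "e \<in> steps"
        have "\<bar>\<mu> lam t x\<bar> * \<bar>a t x e\<bar> \<le> 1 * (2 * lam * R)"
          using \<mu>_le[OF t] nonneg[OF lam(1) t] a_le[OF e] by (intro mult_mono) auto
        then show "\<bar>\<mu> lam t x * a t x e\<bar> \<le> 2 * lam * R" by (simp add: abs_mult)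
      qed
      moreover have "z T = z 0" using periodic[OF lam(1)] by (simp add: z_def u_def T_def fun_eq_iff)
      ultimately have "\<bar>z t x\<bar> \<le> K * (L * (2 * lam * R))"
        using stable[THEN spec, THEN spec, THEN spec, THEN spec, of z "\<lambda>t. forcing (\<mu> lam t) (a t)" "L * (2 * lam * R)" T]
          mean_z T t by blast
      then show ?thesis by (simp add: A_def mult_ac)
    qed
    define w where "w t x = z t x - lam * W t x" for t x
    \<comment> \<open>The source of \<open>w\<close> is regrouped so that both summands are visibly
      of second order: a product of two first-order deviations, and the rates minus their linear
      part, weighted by \<open>\<pi>\<close>.\<close>
    define F where "F t x = forcing (\<lambda>x. \<mu> lam t x - \<pi> x) (a t) x +
      forcing \<pi> (\<lambda>x e. a t x e + - (lam * cos (\<omega> * t)) * b x e) x" for t x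
    have F_eq: "F t x = forcing (\<mu> lam t) (a t) x - lam * (cos (\<omega> * t) * (Psi_fun r \<pi> x \<bullet> v))" for t x
      unfolding F_def forcing_diff forcing_add forcing_cmult
      unfolding b_def forcing_pi by simp
    have Lw: "Lstar (w t) x = Lstar (u t) x - lam * Lstar (W t) x" for t x
      unfolding w_def by (simp add: Lstar_diff Lstar_cmult Lz)
    have dw: "((\<lambda>s. w s x) has_real_derivative Lstar (w t) x + F t x) (at t within {0..})"
      if "0 \<le> t" for t x
      unfolding Lw F_eq unfolding w_def z_def W_def
      by (rule DERIV_cong[OF DERIV_diff[OF DERIV_diff[OF du[OF that] DERIV_const] DERIV_cmult[OF response_deriv[OF \<omega>]]]])
        (simp add: algebra_simps)
    have F_bound: "\<bar>F t x\<bar> \<le> L * (B * lam\<^sup>2)" if t: "0 \<le> t" for t x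
    proof -
      have "\<bar>forcing (\<lambda>x. \<mu> lam t x - \<pi> x) (a t) x\<bar> \<le> L * ((A * lam) * (2 * lam * R))"
      proof (rule forcing)
        fix x and e :: "int ^ 'd" assume e: "e \<in> steps"
        have "\<bar>\<pi> x\<bar> * \<bar>z t x\<bar> \<le> 1 * (A * lam)"
          using z_bound[OF t, of x] pi_le_1[of x] pi_nonneg[of x] by (intro mult_mono) auto
        then have "\<bar>\<mu> lam t x - \<pi> x\<bar> \<le> A * lam"
          by (simp add: \<mu>_eq z_def right_diff_distrib flip: abs_mult)
        then have "\<bar>\<mu> lam t x - \<pi> x\<bar> * \<bar>a t x e\<bar> \<le> (A * lam) * (2 * lam * R)"
          using a_le[OF e] A lam by (intro mult_mono) auto
        then show "\<bar>(\<mu> lam t x - \<pi> x) * a t x e\<bar> \<le> (A * lam) * (2 * lam * R)" by (simp add: abs_mult)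
      qed
      moreover have "\<bar>forcing \<pi> (\<lambda>x e. a t x e + - (lam * cos (\<omega> * t)) * b x e) x\<bar> \<le> L * (lam\<^sup>2 * R)"
      proof (rule forcing)
        fix x and e :: "int ^ 'd" assume e: "e \<in> steps"
        have "\<bar>\<pi> x\<bar> * \<bar>a t x e + - (lam * cos (\<omega> * t)) * b x e\<bar> \<le> 1 * (lam\<^sup>2 * R)"
          using a2_le[OF e] pi_le_1[of x] pi_nonneg[of x] by (intro mult_mono) auto
        then show "\<bar>\<pi> x * (a t x e + - (lam * cos (\<omega> * t)) * b x e)\<bar> \<le> lam\<^sup>2 * R" by (simp only: abs_mult mult_1)
      qed
      ultimately have "\<bar>F t x\<bar> \<le> L * ((A * lam) * (2 * lam * R)) + L * (lam\<^sup>2 * R)"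
        unfolding F_def by linarith
      then show ?thesis by (simp add: B_def algebra_simps power2_eq_square)
    qed
    have mean_w: "(\<Sum>x\<in>UNIV. \<pi> x * w t x) = 0" if "0 \<le> t" for t
    proof -
      have "(\<Sum>x\<in>UNIV. \<pi> x * w t x) = (\<Sum>x\<in>UNIV. \<pi> x * z t x) - lam * (\<Sum>x\<in>UNIV. \<pi> x * W t x)"
        by (simp add: w_def right_diff_distrib sum_subtractf sum_distrib_left mult_ac)
      then show ?thesis using mean_z[OF that] sum_pi_response[OF \<omega>] by (simp add: W_def)
    qed
    have "w T = w 0" using periodic[OF lam(1)] response_periodic[OF \<omega>, of v]
      by (simp add: w_def z_def u_def T_def W_def fun_eq_iff)
    then have "\<bar>w t y\<bar> \<le> K * (L * (B * lam\<^sup>2))"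
      using stable[THEN spec, THEN spec, THEN spec, THEN spec, of w F "L * (B * lam\<^sup>2)" T]
        mean_w T t dw F_bound by blast
    \<comment> \<open>Return from the density to the law, using
      \<open>\<pi> \<le> 1\<close>.\<close>
    then have "\<bar>\<pi> y\<bar> * \<bar>w t y\<bar> \<le> 1 * (K * (L * (B * lam\<^sup>2)))"
      using pi_le_1[of y] pi_nonneg[of y] by (intro mult_mono) auto
    moreover have "\<mu> lam t y - \<pi> y - lam * (\<pi> y * W t y) = \<pi> y * w t y"
      by (simp add: \<mu>_eq w_def z_def algebra_simps)
    ultimately show ?thesis by (simp add: abs_mult mult_ac)
  qed
  then show ?thesis unfolding W_def by blast
qed

end

section \<open>The mobility matrix\<close>

context stationary_walk
begin

text \<open>\<gamma> is real, so the conjugation in the scalar product disappears and the real part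
  falls on the rotated amplitude; linearity of the resolvent absorbs the sum over \<open>k\<close>.
  The right side has the shape that the product rule for the velocity delivers.\<close>

lemma re_mobility:
  assumes "\<omega> \<noteq> 0"
  shows "Re (exp (\<i> * of_real (\<omega> * t)) * (mobility r \<pi> \<omega> *v (\<chi> k. of_real (v $ k))) $ j) =
    (\<Sum>a\<in>UNIV. \<pi> a * (gamma_fun r a $ j * response \<omega> v t a + cos (\<omega> * t) * (v $ j * c_fun r a $ j)))"
proof -
  let ?E = "exp (\<i> * of_real (\<omega> * t))"
  have "(mobility r \<pi> \<omega> *v (\<chi> k. of_real (v $ k))) $ j =
      (\<Sum>k\<in>UNIV. of_real (mean \<pi> (\<lambda>x. c_fun r x $ j)) * of_bool (j = k) * of_real (v $ k)) +
      (\<Sum>k\<in>UNIV. l2_inner \<pi> (cplx_comp (gamma_fun r) j) (resolvent \<omega> (cplx_comp (Psi_fun r \<pi>) k)) * of_real (v $ k))"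
    by (simp add: mobility_def matrix_vector_mult_def distrib_right sum.distrib)
  also have "(\<Sum>k\<in>UNIV. of_real (mean \<pi> (\<lambda>x. c_fun r x $ j)) * of_bool (j = k) * of_real (v $ k)) =
      (\<Sum>k\<in>UNIV. if k = j then complex_of_real (mean \<pi> (\<lambda>x. c_fun r x $ j) * v $ k) else 0)"
    by (intro sum.cong) auto
  also have "\<dots> = of_real (mean \<pi> (\<lambda>x. c_fun r x $ j) * v $ j)"
    by (simp add: sum.delta)
  also have "(\<Sum>k\<in>UNIV. l2_inner \<pi> (cplx_comp (gamma_fun r) j) (resolvent \<omega> (cplx_comp (Psi_fun r \<pi>) k)) * of_real (v $ k)) =
      (\<Sum>a\<in>UNIV. of_real (\<pi> a * gamma_fun r a $ j) * amplitude \<omega> v a)"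
    unfolding amplitude_eq[OF assms] l2_inner_def
    by (simp add: sum_distrib_left sum_distrib_right cplx_comp_def mult_ac)
      (rule sum.swap)
  finally have "?E * (mobility r \<pi> \<omega> *v (\<chi> k. of_real (v $ k))) $ j =
      of_real (mean \<pi> (\<lambda>x. c_fun r x $ j) * v $ j) * ?E +
      (\<Sum>a\<in>UNIV. of_real (\<pi> a * gamma_fun r a $ j) * (?E * amplitude \<omega> v a))"
    by (simp only: distrib_left sum_distrib_left mult_ac)
  then have "Re (?E * (mobility r \<pi> \<omega> *v (\<chi> k. of_real (v $ k))) $ j) =
      mean \<pi> (\<lambda>x. c_fun r x $ j) * v $ j * cos (\<omega> * t) +
      (\<Sum>a\<in>UNIV. \<pi> a * gamma_fun r a $ j * response \<omega> v t a)"
    by (simp only: plus_complex.sel Re_sum Re_complex_of_real Im_complex_of_real times_complex.sel response_def)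
      (simp add: Re_exp)
  then show ?thesis
    by (simp add: mean_def sum_distrib_left sum_distrib_right sum.distrib distrib_left mult_ac)
qed

lemma mobility_laplace:
  assumes "\<omega> \<noteq> 0"
  shows "((\<lambda>s. l2_inner \<pi> (cplx_comp (gamma_fun r) j) (exp_op (resolved \<omega>) s (cplx_comp (Psi_fun r \<pi>) k)))
      has_integral mobility r \<pi> \<omega> $ j $ k - of_real (mean \<pi> (\<lambda>x. c_fun r x $ j)) * of_bool (j = k)) {0..}"
  using laplace_resolvent[OF assms sum_pi_cplx_Psi, of "cplx_comp (gamma_fun r) j"] by (simp add: mobility_def)

lemma gamma_fun_eq: "gamma_fun r x = (\<Sum>e\<in>steps. r x e *\<^sub>R real_vec e)"
proof -
  have "(\<Sum>i\<in>UNIV. r x (axis i 1) * real_of_int (axis i 1 $ j) + r x (- axis i 1) * real_of_int (- (axis i 1 $ j))) =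
      (\<Sum>i\<in>UNIV. if i = j then r x (axis i 1) - r x (- axis i 1) else 0)" for j
    by (intro sum.cong) (auto simp: axis_def)
  then show ?thesis
    by (simp add: gamma_fun_def vec_eq_iff sum_steps)
qed

text \<open>For \<open>e\<close> along the axis i, the product of its component j with its scalar
  product with \<open>v\<close> survives only for i = j, and both signs of \<open>e\<close> give the
  same value; this is the origin of the diagonal term.\<close>

lemma c_fun_eq: "v $ j * c_fun r x $ j = (\<Sum>e\<in>steps. real_of_int (e $ j) * ((real_vec e \<bullet> v) * r x e))"
proof -
  have inner: "real_vec (axis i 1) \<bullet> v = v $ i" for i
  proof -
    have "real_vec (axis i 1) = axis i 1" by (simp add: real_vec_def vec_eq_iff axis_def)
    then show ?thesis by (simp add: inner_axis')
  qed
  have comp: "(axis i 1 :: int ^ 'd) $ j = of_bool (i = j)" for i by (simp add: axis_def)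
  have "(\<Sum>e\<in>steps. real_of_int (e $ j) * ((real_vec e \<bullet> v) * r x e)) =
      (\<Sum>i\<in>UNIV. if i = j then v $ i * (r x (axis i 1) + r x (- axis i 1)) else 0)"
    unfolding sum_steps by (intro sum.cong) (auto simp: inner comp algebra_simps)
  then show ?thesis by (simp add: c_fun_def)
qed

section \<open>Reversible walks: symmetry of the generator, the resolvent and the mobility\<close>

lemma reversible_symmetric:
  fixes f h :: "('n, 'd) torus \<Rightarrow> complex"
  assumes "reversible r \<pi>"
  shows "(\<Sum>x\<in>UNIV. of_real (\<pi> x) * (f x * Lstar h x)) = (\<Sum>x\<in>UNIV. of_real (\<pi> x) * (h x * Lstar f x))"
    (is "?B f h = ?B h f")
proof -
  have rev: "rs x e = r x e" if "e \<in> steps" for x e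
    using assms that by (simp add: reversible_def)
  \<comment> \<open>Detailed balance in directed form; it exchanges each jump with its
    inverse.\<close>
  have flip: "\<pi> x * rs x e = \<pi> (x + to_torus e) * rs (x + to_torus e) (- e)" if "e \<in> steps" for x e
    by (subst pi_rs) (simp add: rev that)
  have expand: "?B f h = (\<Sum>x\<in>UNIV. \<Sum>e\<in>steps. of_real (\<pi> x * rs x e) * (f x * h (x + to_torus e))) -
      (\<Sum>x\<in>UNIV. \<Sum>e\<in>steps. of_real (\<pi> x * rs x e) * (f x * h x))" for f h :: "_ \<Rightarrow> complex"
    by (simp add: Lstar_def sum_distrib_left sum_subtractf[symmetric] scaleR_conv_of_real algebra_simps)
  have "(\<Sum>x\<in>UNIV. \<Sum>e\<in>steps. of_real (\<pi> x * rs x e) * (f x * h (x + to_torus e))) =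
      (\<Sum>e\<in>steps. \<Sum>x\<in>UNIV. of_real (\<pi> (x + to_torus e) * rs (x + to_torus e) (- e)) * (f (x + to_torus e - to_torus e) * h (x + to_torus e)))"
    by (subst sum.swap, intro sum.cong refl arg_cong2[where f = "(*)"] arg_cong[where f = of_real] flip) auto
  also have "\<dots> = (\<Sum>e\<in>steps. \<Sum>x\<in>UNIV. of_real (\<pi> x * rs x (- e)) * (f (x - to_torus e) * h x))"
    by (intro sum.cong refl sum_torus_shift[where g = "\<lambda>x. of_real (\<pi> x * rs x (- _)) * (f (x - to_torus _) * h x)"])
  also have "\<dots> = (\<Sum>e\<in>steps. \<Sum>x\<in>UNIV. of_real (\<pi> x * rs x e) * (f (x + to_torus e) * h x))"
    by (subst sum_steps_uminus[symmetric]) simp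
  also have "\<dots> = (\<Sum>x\<in>UNIV. \<Sum>e\<in>steps. of_real (\<pi> x * rs x e) * (h x * f (x + to_torus e)))"
    by (subst sum.swap) (simp only: mult.commute)
  finally show ?thesis unfolding expand by (simp only: mult.commute)
qed

text \<open>Writing \<open>f\<close> and \<open>h\<close> as images of \<open>F\<close> and
  \<open>H\<close> reduces the claim to the symmetry of \<open>Lstar\<close>. The pairing is
  bilinear, without conjugation, so the frequency term is symmetric too; the mobility thus comes out
  symmetric rather than Hermitian.\<close>

lemma resolvent_symmetric:
  assumes "reversible r \<pi>" "\<omega> \<noteq> 0"
  shows "(\<Sum>x\<in>UNIV. of_real (\<pi> x) * (f x * resolvent \<omega> h x)) = (\<Sum>x\<in>UNIV. of_real (\<pi> x) * (h x * resolvent \<omega> f x))"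
proof -
  define F where "F = resolvent \<omega> f"
  define H where "H = resolvent \<omega> h"
  have f: "f x = \<i> * of_real \<omega> * F x - Lstar F x" and h: "h x = \<i> * of_real \<omega> * H x - Lstar H x" for x
    using fun_cong[OF resolved_resolvent[OF assms(2)]] by (simp_all add: F_def H_def resolved_eq)
  have "(\<Sum>x\<in>UNIV. of_real (\<pi> x) * (f x * H x)) =
      (\<Sum>x\<in>UNIV. of_real (\<pi> x) * (\<i> * of_real \<omega> * F x * H x)) - (\<Sum>x\<in>UNIV. of_real (\<pi> x) * (H x * Lstar F x))"
    by (simp add: f sum_subtractf[symmetric] algebra_simps)
  also have "\<dots> = (\<Sum>x\<in>UNIV. of_real (\<pi> x) * (\<i> * of_real \<omega> * F x * H x)) - (\<Sum>x\<in>UNIV. of_real (\<pi> x) * (F x * Lstar H x))"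
    by (simp only: reversible_symmetric[OF assms(1), of H F])
  also have "\<dots> = (\<Sum>x\<in>UNIV. of_real (\<pi> x) * (h x * F x))"
    by (simp add: h sum_subtractf[symmetric] algebra_simps)
  finally show ?thesis by (simp add: F_def H_def)
qed

lemma reversible_generator:
  assumes "reversible r \<pi>"
  shows "jump_generator rs = jump_generator r"
  using assms by (intro ext) (simp add: jump_generator_eq reversible_def)

lemma reversible_Psi:
  assumes "reversible r \<pi>"
  shows "Psi_fun r \<pi> x = - 2 *\<^sub>R gamma_fun r x"
proof -
  have "Psi_fun r \<pi> x = - (\<Sum>e\<in>steps. 2 *\<^sub>R (r x e *\<^sub>R real_vec e))"
    unfolding Psi_fun_def using assms by (intro arg_cong[of _ _ uminus] sum.cong) (simp_all add: reversible_def)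
  then show ?thesis by (simp add: gamma_fun_eq scaleR_sum_right sum_negf)
qed

lemma reversible_cplx_Psi:
  assumes "reversible r \<pi>"
  shows "cplx_comp (Psi_fun r \<pi>) k = (\<lambda>x. - 2 * cplx_comp (gamma_fun r) k x)"
  by (simp add: cplx_comp_def reversible_Psi[OF assms])

lemma reversible_mobility:
  assumes "reversible r \<pi>" "\<omega> \<noteq> 0"
  shows "mobility r \<pi> \<omega> $ j $ k = of_real (mean \<pi> (\<lambda>x. c_fun r x $ j)) * of_bool (j = k) -
    2 * l2_inner \<pi> (cplx_comp (gamma_fun r) j) (resolvent \<omega> (cplx_comp (gamma_fun r) k))"
  by (simp add: mobility_def reversible_cplx_Psi[OF assms(1)] resolvent_cmult[OF assms(2), of "- 2", simplified]
      l2_inner_def sum_negf sum_distrib_left mult_ac)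

text \<open>The components of \<gamma> are real, so the scalar product with them agrees with the
  bilinear pairing in which the resolvent is symmetric.\<close>

lemma reversible_mobility_symmetric:
  assumes "reversible r \<pi>" "\<omega> \<noteq> 0"
  shows "transpose (mobility r \<pi> \<omega>) = mobility r \<pi> \<omega>"
proof -
  have "l2_inner \<pi> (cplx_comp (gamma_fun r) j) (resolvent \<omega> (cplx_comp (gamma_fun r) k)) =
      l2_inner \<pi> (cplx_comp (gamma_fun r) k) (resolvent \<omega> (cplx_comp (gamma_fun r) j))" for j k
    using resolvent_symmetric[OF assms, of "cplx_comp (gamma_fun r) j" "cplx_comp (gamma_fun r) k"]
    by (simp add: l2_inner_def cplx_comp_def mult.assoc)
  then have "mobility r \<pi> \<omega> $ j $ k = mobility r \<pi> \<omega> $ k $ j" for j k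
    unfolding reversible_mobility[OF assms] by (cases "j = k") auto
  then show ?thesis by (simp add: vec_eq_iff transpose_def)
qed

text \<open>The zero mean behind the convergence of the integral is inherited from \<Psi> = -2
  \<gamma>.\<close>

lemma reversible_laplace:
  assumes "reversible r \<pi>" "\<omega> \<noteq> 0"
  shows "((\<lambda>s. l2_inner \<pi> b (exp_op (resolved \<omega>) s (cplx_comp (gamma_fun r) k)))
    has_integral l2_inner \<pi> b (resolvent \<omega> (cplx_comp (gamma_fun r) k))) {0..}"
proof (rule laplace_resolvent[OF assms(2)])
  have "- 2 * (\<Sum>x\<in>UNIV. of_real (\<pi> x) * cplx_comp (gamma_fun r) k x) = 0"
    using sum_pi_cplx_Psi[of k] by (simp add: reversible_cplx_Psi[OF assms(1)] sum_distrib_left mult_ac)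
  then show "(\<Sum>x\<in>UNIV. of_real (\<pi> x) * cplx_comp (gamma_fun r) k x) = 0" by simp
qed

text \<open>Cauchy-Schwarz bounds the exponent by \<open>lam\<close>, which gives the uniform bound
  \<open>exp lam * R\<close>.\<close>

lemma bounded_lift_perturbed:
  assumes v: "norm v = 1" and lam: "0 \<le> lam"
    and lift: "lifted_walk M (perturbed_rates r v \<omega> lam) X Y"
  shows "\<exists>R. bounded_lift M (perturbed_rates r v \<omega> lam) X Y R"
proof -
  obtain R where R: "0 < R" "\<And>x e. e \<in> steps \<Longrightarrow> r x e \<le> R" using rates_bounded by auto
  have "bounded_lift M (perturbed_rates r v \<omega> lam) X Y (exp lam * R)"
  proof
    fix t x and e :: "int ^ 'd" assume e: "e \<in> steps"
    show "0 \<le> perturbed_rates r v \<omega> lam t x e"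
      using rates_pos[OF e, of x] by (simp add: perturbed_rates_def)
    have "\<bar>real_vec e \<bullet> v\<bar> \<le> 1"
      using Cauchy_Schwarz_ineq2[of "real_vec e" v] norm_real_vec_step[OF e] v by simp
    then have "\<bar>cos (\<omega> * t)\<bar> * \<bar>real_vec e \<bullet> v\<bar> \<le> 1 * 1" by (intro mult_mono) auto
    then have "cos (\<omega> * t) * (real_vec e \<bullet> v) \<le> 1" by (simp add: abs_mult[symmetric] abs_le_iff)
    then have "lam * cos (\<omega> * t) * (real_vec e \<bullet> v) \<le> lam"
      using lam by (simp add: mult.assoc mult_left_le)
    then show "perturbed_rates r v \<omega> lam t x e \<le> exp lam * R"
      unfolding perturbed_rates_def using R(2)[OF e, of x] rates_pos[OF e, of x] by (intro mult_mono) auto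
  qed (rule lift)
  then show ?thesis by blast
qed

end

section \<open>Laws on the torus and assembly of the response formula\<close>

lemma transition_function_master:
  fixes q :: "real \<Rightarrow> ('n::finite, 'd::finite) rates"
  assumes trans: "transition_function (\<lambda>t. torus_rate (q t)) P" and t: "0 \<le> t"
  shows "((\<lambda>s. \<Sum>x\<in>UNIV. \<nu> x * P 0 s x y) has_real_derivative
    (\<Sum>e\<in>steps. (\<Sum>x\<in>UNIV. \<nu> x * P 0 t x (y - to_torus e)) * q t (y - to_torus e) e) -
    (\<Sum>x\<in>UNIV. \<nu> x * P 0 t x y) * (\<Sum>e\<in>steps. q t y e)) (at t within {0..})"
proof -
  have D: "((\<lambda>u. P 0 u x y) has_real_derivative
      (\<Sum>e\<in>steps. P 0 t x (y - to_torus e) * q t (y - to_torus e) e) - P 0 t x y * (\<Sum>e\<in>steps. q t y e))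
      (at t within {0..})" for x
    using trans[unfolded transition_function_def, THEN spec[of _ 0], THEN mp, OF order_refl,
        THEN spec[of _ x], THEN conjunct2, THEN spec[of _ t], THEN mp, OF t, THEN conjunct2, THEN conjunct2, THEN spec[of _ y]]
    by (simp add: sum_torus_rate_into sum_torus_rate_out)
  have "((\<lambda>s. \<Sum>x\<in>UNIV. \<nu> x * P 0 s x y) has_real_derivative
      (\<Sum>x\<in>UNIV. \<nu> x * ((\<Sum>e\<in>steps. P 0 t x (y - to_torus e) * q t (y - to_torus e) e) - P 0 t x y * (\<Sum>e\<in>steps. q t y e))))
      (at t within {0..})"
    by (intro DERIV_sum DERIV_cmult D)
  also have "(\<Sum>x\<in>UNIV. \<nu> x * ((\<Sum>e\<in>steps. P 0 t x (y - to_torus e) * q t (y - to_torus e) e) - P 0 t x y * (\<Sum>e\<in>steps. q t y e))) =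
      (\<Sum>x\<in>UNIV. \<Sum>e\<in>steps. \<nu> x * P 0 t x (y - to_torus e) * q t (y - to_torus e) e) -
      (\<Sum>x\<in>UNIV. \<nu> x * P 0 t x y * (\<Sum>e\<in>steps. q t y e))"
    by (simp add: right_diff_distrib sum_subtractf sum_distrib_left mult.assoc)
  also have "\<dots> = (\<Sum>e\<in>steps. (\<Sum>x\<in>UNIV. \<nu> x * P 0 t x (y - to_torus e)) * q t (y - to_torus e) e) -
      (\<Sum>x\<in>UNIV. \<nu> x * P 0 t x y) * (\<Sum>e\<in>steps. q t y e)"
    by (subst sum.swap) (simp only: sum_distrib_right)
  finally show ?thesis .
qed

lemma markov_process_law:
  fixes X :: "real \<Rightarrow> 'w \<Rightarrow> 's::finite"
  assumes markov: "markov_process M P X" and t: "0 \<le> t"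
  shows "measure M {w \<in> space M. X t w = y} = (\<Sum>x\<in>UNIV. measure M {w \<in> space M. X 0 w = x} * P 0 t x y)"
proof -
  interpret prob_space M using markov by (simp add: markov_process_def)
  have meas: "{w \<in> space M. X s w = x} \<in> events" if "0 \<le> s" for s x
  proof -
    have "X s \<in> measurable M (count_space UNIV)" using markov that by (simp add: markov_process_def)
    then show ?thesis by measurable
  qed
  have both: "{w \<in> space M. X 0 w = x \<and> X t w = y} \<in> events" for x
    using sets.Int[OF meas[OF order_refl, of x] meas[OF t, of y]]
    by (rule back_subst[of "\<lambda>A. A \<in> events"]) auto
  have "measure M {w \<in> space M. X t w = y} = (\<Sum>x\<in>UNIV. measure M {w \<in> space M. X 0 w = x \<and> X t w = y})"
    by (rule prob_sum) (auto simp: both meas t)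
  then show ?thesis by (simp add: markov_process_two_times[OF markov order_refl t])
qed

theorem theorem5p1:
  fixes r :: "('n::finite, 'd::finite) rates"
    and v :: "real ^ 'd" and \<omega> :: real
    and P :: "real \<Rightarrow> real \<Rightarrow> real \<Rightarrow> ('n, 'd) torus \<Rightarrow> ('n, 'd) torus \<Rightarrow> real"
    and \<pi> :: "('n, 'd) torus \<Rightarrow> real"
    and \<pi>' :: "real \<Rightarrow> ('n, 'd) torus \<Rightarrow> real"
    and M :: "real \<Rightarrow> 'w measure"
    and X :: "real \<Rightarrow> real \<Rightarrow> 'w \<Rightarrow> ('n, 'd) torus"
    and Y :: "real \<Rightarrow> real \<Rightarrow> 'w \<Rightarrow> int ^ 'd"
  assumes rates_pos: "\<And>x e. e \<in> steps \<Longrightarrow> 0 < r x e"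
    and v: "norm v = 1"
    and \<omega>: "\<omega> \<noteq> 0"
    and transition: "\<And>lam. 0 \<le> lam \<Longrightarrow>
          transition_function (\<lambda>t. torus_rate (perturbed_rates r v \<omega> lam t)) (P lam)"
    and invariant: "\<And>t. 0 \<le> t \<Longrightarrow> invariant_distribution (P 0 0 t) \<pi>"
    and oscillatory: "\<And>lam. 0 \<le> lam \<Longrightarrow>
          invariant_distribution (P lam 0 (2 * pi / \<bar>\<omega>\<bar>)) (\<pi>' lam)"
    and walk: "\<And>lam. 0 \<le> lam \<Longrightarrow> markov_process (M lam) (P lam) (X lam)"
    and initial: "\<And>lam x. 0 \<le> lam \<Longrightarrow>
          measure (M lam) {w \<in> space (M lam). X lam 0 w = x} = \<pi>' lam x"
    and lift: "\<And>lam. 0 \<le> lam \<Longrightarrow>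
          lifted_walk (M lam) (perturbed_rates r v \<omega> lam) (X lam) (Y lam)"
  shows "(\<forall>t\<ge>0. ((\<lambda>lam. mean_velocity (M lam) (Y lam) t) has_vector_derivative
            (\<chi> j. Re (exp (\<i> * of_real (\<omega> * t)) *
                      (mobility r \<pi> \<omega> *v (\<chi> k. of_real (v $ k))) $ j)))
            (at 0 within {0..})) \<and>
     (\<forall>j k.
        (\<lambda>s. l2_inner \<pi> (cplx_comp (gamma_fun r) j)
               (exp_op (freq_minus \<omega> (jump_generator (rev_rates r \<pi>))) s (cplx_comp (Psi_fun r \<pi>) k)))
          integrable_on {0..} \<and>
        mobility r \<pi> \<omega> $ j $ k =
          of_real (mean \<pi> (\<lambda>x. c_fun r x $ j)) * of_bool (j = k) +
          integral {0..} (\<lambda>s. l2_inner \<pi> (cplx_comp (gamma_fun r) j)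
            (exp_op (freq_minus \<omega> (jump_generator (rev_rates r \<pi>))) s (cplx_comp (Psi_fun r \<pi>) k)))) \<and>
     (reversible r \<pi> \<longrightarrow>
        (\<forall>x. Psi_fun r \<pi> x = - 2 *\<^sub>R gamma_fun r x) \<and>
        jump_generator (rev_rates r \<pi>) = jump_generator r \<and>
        transpose (mobility r \<pi> \<omega>) = mobility r \<pi> \<omega> \<and>
        (\<forall>j k.
           mobility r \<pi> \<omega> $ j $ k =
             of_real (mean \<pi> (\<lambda>x. c_fun r x $ j)) * of_bool (j = k) -
             2 * l2_inner \<pi> (cplx_comp (gamma_fun r) j)
                   (inv_into UNIV (freq_minus \<omega> (jump_generator r)) (cplx_comp (gamma_fun r) k)) \<and>
           (\<lambda>s. l2_inner \<pi> (cplx_comp (gamma_fun r) j)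
                  (exp_op (freq_minus \<omega> (jump_generator r)) s (cplx_comp (gamma_fun r) k)))
             integrable_on {0..} \<and>
           mobility r \<pi> \<omega> $ j $ k =
             of_real (mean \<pi> (\<lambda>x. c_fun r x $ j)) * of_bool (j = k) -
             2 * integral {0..} (\<lambda>s. l2_inner \<pi> (cplx_comp (gamma_fun r) j)
                   (exp_op (freq_minus \<omega> (jump_generator r)) s (cplx_comp (gamma_fun r) k)))))"
proof -
  have trans0: "transition_function (\<lambda>t. torus_rate r) (P 0)"
  proof -
    have "perturbed_rates r v \<omega> 0 t = r" for t by (simp add: perturbed_rates_def fun_eq_iff)
    then show ?thesis using transition[of 0] by simp
  qed
  have P_refl: "P lam 0 0 x y = of_bool (x = y)" if "0 \<le> lam" for lam x y
    using transition[OF that] unfolding transition_function_def by blast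
  have P_nonneg: "0 \<le> P lam 0 t x y" if "0 \<le> lam" "0 \<le> t" for lam t x y
    using transition[OF that(1)] that(2) unfolding transition_function_def by blast
  have P_sum: "(\<Sum>y\<in>UNIV. P lam 0 t x y) = 1" if "0 \<le> lam" "0 \<le> t" for lam t x
  proof -
    have "(P lam 0 t x has_sum 1) UNIV"
      using transition[OF that(1)] that(2) unfolding transition_function_def by blast
    then show ?thesis by (simp add: has_sum_finite_iff)
  qed
  interpret stationary_walk r \<pi>
  proof
    show "0 < r x e" if "e \<in> steps" for x e using rates_pos[OF that] .
    show "0 \<le> \<pi> x" "(\<Sum>x\<in>UNIV. \<pi> x) = 1" for x
      using invariant[of 0] by (auto simp: invariant_distribution_def)
    fix y
    have inv: "(\<Sum>x\<in>UNIV. \<pi> x * P 0 0 t x z) = \<pi> z" if "0 \<le> t" for t z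
      using invariant[OF that] by (simp add: invariant_distribution_def)
    \<comment> \<open>The forward equation at time 0, started from \<open>\<pi>\<close>: by
      invariance the left side is constant in time, and uniqueness of the one-sided derivative makes
      the right side vanish.\<close>
    have "((\<lambda>s. \<Sum>x\<in>UNIV. \<pi> x * P 0 0 s x y) has_real_derivative
        (\<Sum>e\<in>steps. \<pi> (y - to_torus e) * r (y - to_torus e) e) - \<pi> y * (\<Sum>e\<in>steps. r y e)) (at 0 within {0..})"
      using transition_function_master[OF trans0 order_refl, of \<pi> y] by (simp add: inv)
    then have deriv: "((\<lambda>s. \<pi> y) has_real_derivative
        (\<Sum>e\<in>steps. \<pi> (y - to_torus e) * r (y - to_torus e) e) - \<pi> y * (\<Sum>e\<in>steps. r y e)) (at 0 within {0..})"
      by (rule has_field_derivative_transform_within[OF _ zero_less_one]) (auto simp: inv)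
    have const: "((\<lambda>s. \<pi> y) has_real_derivative 0) (at 0 within {0..})" by simp
    have nontriv: "at (0 :: real) within {0..} \<noteq> bot"
      by (simp add: at_within_Ici_at_right)
    have "(\<Sum>e\<in>steps. \<pi> (y - to_torus e) * r (y - to_torus e) e) - \<pi> y * (\<Sum>e\<in>steps. r y e) = 0"
      using vector_derivative_within[OF nontriv deriv[unfolded has_real_derivative_iff_has_vector_derivative]]
        vector_derivative_within[OF nontriv const[unfolded has_real_derivative_iff_has_vector_derivative]]
      by simp
    then show "(\<Sum>e\<in>steps. \<pi> (y - to_torus e) * r (y - to_torus e) e) = \<pi> y * (\<Sum>e\<in>steps. r y e)" by simp
  qed
  define \<mu> where "\<mu> lam t y = (\<Sum>x\<in>UNIV. \<pi>' lam x * P lam 0 t x y)" for lam t y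
  have osc: "(\<forall>x. 0 \<le> \<pi>' lam x) \<and> (\<Sum>x\<in>UNIV. \<pi>' lam x) = 1 \<and> \<mu> lam (2 * pi / \<bar>\<omega>\<bar>) = \<pi>' lam" if "0 \<le> lam" for lam
    using oscillatory[OF that] by (auto simp: invariant_distribution_def \<mu>_def)
  have \<mu>_0: "\<mu> lam 0 = \<pi>' lam" if "0 \<le> lam" for lam
    by (simp add: \<mu>_def fun_eq_iff P_refl[OF that] of_bool_def if_distrib[of "(*) _"] sum.delta cong: if_cong)
  have law: "measure (M lam) {w \<in> space (M lam). X lam t w = y} = \<mu> lam t y" if "0 \<le> lam" "0 \<le> t" for lam t y
    using markov_process_law[OF walk[OF that(1)] that(2)] initial[OF that(1)] by (simp add: \<mu>_def)
  have master: "((\<lambda>s. \<mu> lam s y) has_real_derivative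
      (\<Sum>e\<in>steps. \<mu> lam t (y - to_torus e) * perturbed_rates r v \<omega> lam t (y - to_torus e) e) -
      \<mu> lam t y * (\<Sum>e\<in>steps. perturbed_rates r v \<omega> lam t y e)) (at t within {0..})" if "0 \<le> lam" "0 \<le> t" for lam t y
    unfolding \<mu>_def by (rule transition_function_master[OF transition[OF that(1)] that(2)])
  have "\<exists>C. \<forall>lam t y. 0 \<le> lam \<and> lam \<le> 1 \<and> 0 \<le> t \<longrightarrow>
    \<bar>\<mu> lam t y - \<pi> y - lam * (\<pi> y * response \<omega> v t y)\<bar> \<le> C * lam\<^sup>2"
  proof (rule steady_state_expansion[OF v \<omega> master])
    show "0 \<le> \<mu> lam t y" if "0 \<le> lam" "0 \<le> t" for lam t y
      unfolding \<mu>_def using osc[OF that(1)] P_nonneg[OF that] by (intro sum_nonneg mult_nonneg_nonneg) auto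
    show "(\<Sum>y\<in>UNIV. \<mu> lam t y) = 1" if "0 \<le> lam" "0 \<le> t" for lam t
      unfolding \<mu>_def by (subst sum.swap) (simp add: sum_distrib_left[symmetric] P_sum[OF that] osc[OF that(1)])
    show "\<mu> lam (2 * pi / \<bar>\<omega>\<bar>) = \<mu> lam 0" if "0 \<le> lam" for lam
      using osc[OF that] \<mu>_0[OF that] by simp
  qed
  then obtain C where C: "\<And>lam t y. 0 \<le> lam \<Longrightarrow> lam \<le> 1 \<Longrightarrow> 0 \<le> t \<Longrightarrow>
    \<bar>\<mu> lam t y - \<pi> y - lam * (\<pi> y * response \<omega> v t y)\<bar> \<le> C * lam\<^sup>2" by blast
  have velocity: "mean_velocity (M lam) (Y lam) t =
      (\<chi> j. \<Sum>a\<in>UNIV. (\<Sum>e\<in>steps. real_of_int (e $ j) * perturbed_rates r v \<omega> lam t a e) * \<mu> lam t a)"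
    if lam: "0 \<le> lam" and t: "0 \<le> t" for lam t
  proof -
    obtain R where "bounded_lift (M lam) (perturbed_rates r v \<omega> lam) (X lam) (Y lam) R"
      using bounded_lift_perturbed[OF v lam lift[OF lam]] by blast
    then interpret walk: bounded_lift "M lam" "perturbed_rates r v \<omega> lam" "X lam" "Y lam" R .
    have "continuous_on {0..} (\<lambda>s. perturbed_rates r v \<omega> lam s a e)" for a e
      unfolding perturbed_rates_def by (intro continuous_intros)
    moreover have "continuous_on {0..} (\<lambda>s. measure (M lam) {w \<in> space (M lam). X lam s w = a})" for a
    proof -
      have "continuous_on {0..} (\<lambda>s. \<mu> lam s a)"
        by (rule DERIV_continuous_on[OF master[OF lam]]) simp
      then show ?thesis by (rule continuous_on_eq) (simp add: law[OF lam])
    qed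
    ultimately show ?thesis
      by (subst walk.mean_velocity_eq) (simp_all add: t law[OF lam t])
  qed
  have derivative: "((\<lambda>lam. mean_velocity (M lam) (Y lam) t) has_vector_derivative
      (\<chi> j. Re (exp (\<i> * of_real (\<omega> * t)) * (mobility r \<pi> \<omega> *v (\<chi> k. of_real (v $ k))) $ j)))
      (at 0 within {0..})" if t: "0 \<le> t" for t
  proof (rule has_vector_derivative_vec)
    fix j
    have \<mu>_deriv: "((\<lambda>lam. \<mu> lam t a) has_real_derivative \<pi> a * response \<omega> v t a) (at 0 within {0..})" for a
      by (rule DERIV_of_quadratic_bound) (rule C[OF _ _ t])
    \<comment> \<open>At \<open>lam = 0\<close> the expansion has no error, so the steady state
      there is \<open>\<pi>\<close>: uniqueness of the invariant law of the unperturbed period map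
      is a by-product.\<close>
    have \<mu>_zero: "\<mu> 0 t a = \<pi> a" for a using C[of 0 t a] t by simp
    have rate_deriv: "((\<lambda>lam. perturbed_rates r v \<omega> lam t a e) has_real_derivative
        cos (\<omega> * t) * ((real_vec e \<bullet> v) * r a e)) (at 0 within {0..})" for a e
      unfolding perturbed_rates_def by (auto intro!: derivative_eq_intros)
    have rate_zero: "perturbed_rates r v \<omega> 0 t a e = r a e" for a e by (simp add: perturbed_rates_def)
    \<comment> \<open>Product rule: varying the rates gives the mean of \<open>c_fun\<close>,
      varying the law gives the pairing of \<open>gamma_fun\<close> with the response.\<close>
    have "((\<lambda>lam. \<Sum>a\<in>UNIV. (\<Sum>e\<in>steps. real_of_int (e $ j) * perturbed_rates r v \<omega> lam t a e) * \<mu> lam t a)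
        has_real_derivative (\<Sum>a\<in>UNIV.
          (\<Sum>e\<in>steps. real_of_int (e $ j) * (cos (\<omega> * t) * ((real_vec e \<bullet> v) * r a e))) * \<mu> 0 t a +
          \<pi> a * response \<omega> v t a * (\<Sum>e\<in>steps. real_of_int (e $ j) * perturbed_rates r v \<omega> 0 t a e)))
        (at 0 within {0..})"
      by (intro DERIV_sum DERIV_mult DERIV_cmult \<mu>_deriv rate_deriv)
    also have "(\<Sum>a\<in>UNIV.
          (\<Sum>e\<in>steps. real_of_int (e $ j) * (cos (\<omega> * t) * ((real_vec e \<bullet> v) * r a e))) * \<mu> 0 t a +
          \<pi> a * response \<omega> v t a * (\<Sum>e\<in>steps. real_of_int (e $ j) * perturbed_rates r v \<omega> 0 t a e)) =
        Re (exp (\<i> * of_real (\<omega> * t)) * (mobility r \<pi> \<omega> *v (\<chi> k. of_real (v $ k))) $ j)"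
      unfolding re_mobility[OF \<omega>] c_fun_eq gamma_fun_eq
      by (intro sum.cong refl) (simp add: \<mu>_zero rate_zero sum_distrib_left algebra_simps)
    finally show "((\<lambda>lam. mean_velocity (M lam) (Y lam) t $ j) has_real_derivative
        (\<chi> j. Re (exp (\<i> * of_real (\<omega> * t)) * (mobility r \<pi> \<omega> *v (\<chi> k. of_real (v $ k))) $ j)) $ j)
        (at 0 within {0..})"
      by (simp only: vec_lambda_beta, elim has_field_derivative_transform_within[OF _ zero_less_one])
        (simp_all add: velocity[OF _ t])
  qed
  show ?thesis
  proof (intro conjI allI impI, goal_cases)
    case (1 t)
    then show ?case by (rule derivative)
  next
    case (2 j k)
    show ?case by (rule has_integral_integrable[OF mobility_laplace[OF \<omega>]])
  next
    case (3 j k)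
    show ?case unfolding integral_unique[OF mobility_laplace[OF \<omega>]] by simp
  next
    case (4 x)
    then show ?case by (rule reversible_Psi)
  next
    case 5
    then show ?case by (rule reversible_generator)
  next
    case 6
    then show ?case by (rule reversible_mobility_symmetric[OF _ \<omega>])
  next
    case (7 j k)
    show ?case unfolding reversible_generator[OF 7, symmetric] by (rule reversible_mobility[OF 7 \<omega>])
  next
    case (8 j k)
    show ?case unfolding reversible_generator[OF 8, symmetric]
      by (rule has_integral_integrable[OF reversible_laplace[OF 8 \<omega>]])
  next
    case (9 j k)
    show ?case unfolding reversible_generator[OF 9, symmetric] integral_unique[OF reversible_laplace[OF 9 \<omega>]]
      by (rule reversible_mobility[OF 9 \<omega>])
  qed
qed

end
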